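(* Let $\alpha\in\{8,13,18,23\}$. For all integers $n\geqslant 0$, $$b_4(25n+\alpha) \equiv 0\pmod {16}.$$
   Context: $b_4(n)$ is the number of $4$-regular partitions of $n$, i.e. partitions of $n$ with no part divisible by $4$; equivalently $\sum_{n\geqslant 0} b_4(n)q^n=\prod_{m\geqslant 1}\frac{1-q^{4m}}{1-q^m}$. *)

theory Defs
  imports "HOL-Library.Multiset" "HOL-Number_Theory.Cong"
begin

text \<open>A partition of \<open>n\<close> is encoded as the finite multiset of its parts: positive integers summing to \<open>n\<close>.\<close>

definition partitions_of :: "nat \<Rightarrow> nat multiset set" where
  "partitions_of n = {P. 0 \<notin># P \<and> sum_mset P = n}"

definition regular :: "nat \<Rightarrow> nat multiset \<Rightarrow> bool" where
  "regular k P \<longleftrightarrow> (\<forall>p\<in>#P. \<not> k dvd p)"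

definition regular_count :: "nat \<Rightarrow> nat \<Rightarrow> nat" where
  "regular_count k n = card {P \<in> partitions_of n. regular k P}"

abbreviation b4 :: "nat \<Rightarrow> nat" where
  "b4 n \<equiv> regular_count 4 n"

text \<open>There are finitely many partitions of \<open>n\<close>, so \<open>card\<close> above never takes its default value on
  an infinite set.\<close>

lemma finite_partitions_of: "finite (partitions_of n)"
proof (rule finite_subset)
  show "partitions_of n \<subseteq> mset ` {xs. set xs \<subseteq> {..n} \<and> length xs \<le> n}"
  proof
    fix P assume P: "P \<in> partitions_of n"
    obtain xs where xs: "mset xs = P" by (metis ex_mset)
    have nz: "0 \<notin> set xs" and s: "sum_list xs = n"
      using P xs by (auto simp: partitions_of_def simp flip: sum_mset_sum_list set_mset_mset)
    have "length ys \<le> sum_list ys" if "0 \<notin> set ys" for ys :: "nat list"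
      using that by (induction ys) auto
    then have "length xs \<le> n" using nz s by blast
    moreover have "set xs \<subseteq> {..n}" using s member_le_sum_list by auto
    ultimately show "P \<in> mset ` {xs. set xs \<subseteq> {..n} \<and> length xs \<le> n}" using xs by blast
  qed
  show "finite (mset ` {xs. set xs \<subseteq> {..n} \<and> length xs \<le> n})"
    by (intro finite_imageI finite_lists_length_le) simp
qed

end

theory Submission
  imports Defs "HOL-Computational_Algebra.Formal_Power_Series"
begin

unbundle fps_syntax

text \<open>
Write \<open>phi\<close> for the sum of \<open>q^(i^2)\<close> over all integers \<open>i\<close>, \<open>psi\<close> for the sum of
\<open>q^(k (k + 1) / 2)\<close> over \<open>k \<ge> 0\<close>, and \<open>B\<close> for the generating function of \<open>b4\<close>.

The product formulas of Gauss for the two theta series give \<open>B(q) phi(-q) = psi(-q)\<close>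
(\<open>b4_series_phi_neg\<close>), so that \<open>(-1)^n b4(n)\<close> is the coefficient of \<open>q^n\<close> in \<open>psi / phi\<close>.
Since \<open>phi^2 = 1 + 4 L\<close> with \<open>L\<close> integral,
\<open>psi / phi - 2 psi phi + psi phi^3 = (psi / phi) (1 - phi^2)^2\<close> is divisible by 16. Hence
\<open>(-1)^n b4(n)\<close> is congruent modulo 16 to the \<open>n\<close>-th coefficient of \<open>2 psi phi - psi phi^3\<close>, and these
two products have coefficients that can be understood arithmetically in terms of \<open>N = 8 n + 1\<close>.

For \<open>n = 25 m + \<alpha>\<close> with \<open>\<alpha>\<close> as in the theorem, \<open>N = 5 M\<close> with \<open>M\<close> prime to 5 and
\<open>M \<equiv> 5 (mod 8)\<close>. The coefficient of \<open>psi phi\<close> counts solutions of \<open>x^2 + 8 y^2 = N\<close>. As -2 is not a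
square modulo 5, 5 would divide \<open>x\<close> and \<open>y\<close>, and 25 would divide \<open>N\<close>; so there are none
(\<open>psi_phi_nth_eq_0\<close>). The coefficient of \<open>psi phi^3\<close> is a weight two divisor sum,
\<open>\<Sum> chi_8(d) N / d\<close> over \<open>d dvd N\<close> (\<open>psi_phi_cubed_nth\<close>). The factor 5 contributes \<open>5 + chi_8(5) = 4\<close>,
and exchanging each divisor \<open>d\<close> of \<open>M\<close> with \<open>M / d\<close> yields another 4
(\<open>sixteen_dvd_twisted_divisor_sum\<close>).

The formula for \<open>psi phi^3\<close> is the main work. Repeated extraction of even exponents turns it into
the coefficient of \<open>x^N\<close> in \<open>x phi(x) phi(x^2) psi(x^4)^2\<close>. The two factors \<open>phi(x) phi(x^2)\<close> and
\<open>x psi(x^4)^2\<close> have weight one and are, up to a constant term and a factor, divisor series for the characters of discriminant -8 and -4;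
their product is a sum over the solutions of \<open>a x + b y = N\<close> in positive integers, which Liouville's
elementary method (\<open>liouville_parity\<close>) evaluates. The same lemma, with other weights, also proves the two
weight one formulas. For \<open>x psi(x^4)^2\<close> it verifies the differential equation given by the logarithmic
derivative of the product for \<open>psi\<close> (\<open>psi_squared_divisor_series\<close>); this yields
\<open>phi^2\<close> by dissection (\<open>phi_squared_divisor_series\<close>). For \<open>phi(x) phi(x^2)\<close> it shows that the square of the
expected divisor series equals \<open>phi(x)^2 phi(x^2)^2\<close>, and power series with constant term 1 are
determined by their squares (\<open>phi_phi_dilate\<close>).
\<close>

section \<open>Finite forms of two theta identities of Gauss\<close>

text \<open>A finite form, due to Shanks, of \<open>1 + 2 \<Sum> (-1)^s q^(s^2) = \<Prod> (1 - q^k) / (1 + q^k)\<close>, cleared of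
denominators. On the right every summand carries the factor \<open>q^(n + 1)\<close>, so for growing \<open>n\<close> only the
product \<open>N 0 n\<close> remains. Passing from \<open>n\<close> to \<open>n + 1\<close> multiplies the \<open>s\<close>-th summand by
\<open>1 + q^(n + 1)\<close>, up to a difference \<open>u s - u (s + 1)\<close>, and the induction step is a telescoping sum.\<close>

lemma shanks_phi:
  fixes q :: "'a::comm_ring_1"
  defines "D \<equiv> (\<lambda>n. \<Prod>k<n. 1 + q ^ Suc k)"
    and "N \<equiv> (\<lambda>s n. \<Prod>k=s..<n. 1 - q ^ Suc k)"
  shows "D n * (1 + 2 * (\<Sum>s<n. (-1) ^ Suc s * q ^ (Suc s)\<^sup>2))
    = N 0 n + 2 * (\<Sum>s<n. (-1) ^ Suc s * q ^ (Suc s * Suc n) * D s * N (Suc s) n)"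
proof (induction n)
  case 0
  show ?case by (simp add: D_def N_def)
next
  case (Suc n)
  define u where "u s = (-1) ^ s * q ^ (Suc s * Suc n) * D s * N s n" for s
  have DS: "D (Suc s) = D s * (1 + q ^ Suc s)" for s by (simp add: D_def)
  have NS: "N s (Suc n) = N s n * (1 - q ^ Suc n)" if "s \<le> n" for s
    using that by (simp add: N_def)
  have N1: "N s n = (1 - q ^ Suc s) * N (Suc s) n" if "s < n" for s
    using that by (simp add: N_def prod.atLeast_Suc_lessThan)
  have N_refl: "N s s = 1" for s by (simp add: N_def)
  have step: "(-1) ^ Suc s * q ^ (Suc s * Suc (Suc n)) * D s * N (Suc s) (Suc n)
      = (1 + q ^ Suc n) * ((-1) ^ Suc s * q ^ (Suc s * Suc n) * D s * N (Suc s) n) + (u s - u (Suc s))"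
    if "s < n" for s
  proof -
    have "q ^ (Suc s * Suc (Suc n)) = q ^ (Suc s * Suc n) * q ^ Suc s"
      "q ^ (Suc (Suc s) * Suc n) = q ^ (Suc s * Suc n) * q ^ Suc n"
      unfolding power_add[symmetric] by (rule arg_cong[where f = "\<lambda>k. q ^ k"], simp)+
    then show ?thesis
      unfolding u_def N1[OF that] NS[OF Suc_leI[OF that]] DS by (simp only:) (simp add: algebra_simps)
  qed
  have "(\<Sum>s<Suc n. (-1) ^ Suc s * q ^ (Suc s * Suc (Suc n)) * D s * N (Suc s) (Suc n))
      = (1 + q ^ Suc n) * (\<Sum>s<n. (-1) ^ Suc s * q ^ (Suc s * Suc n) * D s * N (Suc s) n)
        + (\<Sum>s<n. u s - u (Suc s)) + (-1) ^ Suc n * q ^ (Suc n * Suc (Suc n)) * D n"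
    by (simp add: step sum.distrib sum_distrib_left N_refl del: mult_Suc mult_Suc_right power_Suc)
  also have "(\<Sum>s<n. u s - u (Suc s)) = u 0 - u n"
    by (rule sum_lessThan_telescope')
  also have "u 0 = q ^ Suc n * N 0 n" by (simp add: u_def D_def)
  also have "u n = (-1) ^ n * q ^ (Suc n * Suc n) * D n" by (simp add: u_def N_refl)
  finally have R: "(\<Sum>s<Suc n. (-1) ^ Suc s * q ^ (Suc s * Suc (Suc n)) * D s * N (Suc s) (Suc n))
      = (1 + q ^ Suc n) * (\<Sum>s<n. (-1) ^ Suc s * q ^ (Suc s * Suc n) * D s * N (Suc s) n)
        + (q ^ Suc n * N 0 n - (-1) ^ n * q ^ (Suc n * Suc n) * D n)
        + (-1) ^ Suc n * q ^ (Suc n * Suc (Suc n)) * D n" .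
  have p: "q ^ (Suc n * Suc (Suc n)) = q ^ (Suc n * Suc n) * q ^ Suc n"
    by (simp only: power_add[symmetric] mult_Suc_right add.commute)
  have sq: "(Suc n)\<^sup>2 = Suc n * Suc n" by (rule power2_eq_square)
  have "D (Suc n) * (1 + 2 * (\<Sum>s<Suc n. (-1) ^ Suc s * q ^ (Suc s)\<^sup>2))
      = (1 + q ^ Suc n) * (D n * (1 + 2 * (\<Sum>s<n. (-1) ^ Suc s * q ^ (Suc s)\<^sup>2)))
        + 2 * D n * (1 + q ^ Suc n) * ((-1) ^ Suc n * q ^ (Suc n * Suc n))"
    unfolding DS sum.lessThan_Suc sq by (simp add: algebra_simps del: mult_Suc mult_Suc_right power_Suc)
  also have "\<dots> = N 0 (Suc n)
      + 2 * (\<Sum>s<Suc n. (-1) ^ Suc s * q ^ (Suc s * Suc (Suc n)) * D s * N (Suc s) (Suc n))"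
    unfolding Suc.IH R p NS[OF le0] unfolding power_Suc[of "-1" n]
    by (simp add: algebra_simps del: mult_Suc mult_Suc_right power_Suc)
  finally show ?case .
qed

text \<open>The companion of \<open>shanks_phi\<close> for triangular exponents, a finite form of
\<open>\<Sum> q^(s (s + 1) / 2) = \<Prod> (1 - q^(2 k)) / (1 - q^(2 k - 1))\<close>: on the right only the summand
\<open>s = 0\<close> survives as \<open>n\<close> grows. The induction step telescopes again.\<close>

lemma shanks_psi:
  fixes q :: "'a::comm_ring_1"
  defines "O' \<equiv> (\<lambda>n. \<Prod>k<n. 1 - q ^ (2 * k + 1))"
    and "E \<equiv> (\<lambda>s n. \<Prod>k=s..<n. 1 - q ^ (2 * k + 2))"
  shows "O' n * (\<Sum>s<2 * n. q ^ (s * (s + 1) div 2)) = (\<Sum>s<n. q ^ (s * (2 * n + 1)) * O' s * E s n)"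
proof (induction n)
  case 0
  show ?case by simp
next
  case (Suc n)
  define v where "v s = q ^ (s * (2 * n + 1)) * (1 - q ^ (2 * s)) * O' s * E s n" for s
  have OS: "O' (Suc s) = O' s * (1 - q ^ (2 * s + 1))" for s by (simp add: O'_def)
  have ES: "E s (Suc n) = E s n * (1 - q ^ (2 * n + 2))" if "s \<le> n" for s
    using that by (simp add: E_def)
  have E1: "E s n = (1 - q ^ (2 * s + 2)) * E (Suc s) n" if "s < n" for s
    using that by (simp add: E_def prod.atLeast_Suc_lessThan)
  have E_refl: "E s s = 1" for s by (simp add: E_def)
  have pw: "q ^ (s * (2 * Suc n + 1)) = q ^ (s * (2 * n + 1)) * q ^ (2 * s)" for s
    by (simp add: power_add[symmetric] algebra_simps)
  have step: "q ^ (s * (2 * Suc n + 1)) * O' s * E s (Suc n)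
      = (1 - q ^ (2 * n + 1)) * (q ^ (s * (2 * n + 1)) * O' s * E s n) + (v (Suc s) - v s)"
    if "s < n" for s
  proof -
    have a: "q ^ (Suc s * (2 * n + 1)) = q ^ (s * (2 * n + 1)) * q ^ (2 * n + 1)"
      by (simp add: power_add[symmetric] algebra_simps)
    have b: "q ^ (2 * n + 2) = q ^ (2 * n + 1) * q" "q ^ (2 * s + 1) = q ^ (2 * s) * q" "q ^ (2 * Suc s) = q ^ (2 * s + 2)"
      by (simp_all add: power_add)
    have c: "v (Suc s) = q ^ (s * (2 * n + 1)) * q ^ (2 * n + 1) * O' s * (1 - q ^ (2 * s) * q) * E s n"
      unfolding v_def E1[OF that] OS a b by (simp add: algebra_simps)
    show ?thesis
      unfolding c unfolding v_def ES[OF less_imp_le[OF that]] pw b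
      by (simp only: algebra_simps mult_1_left)
  qed
  have "(\<Sum>s<Suc n. q ^ (s * (2 * Suc n + 1)) * O' s * E s (Suc n))
      = (1 - q ^ (2 * n + 1)) * (\<Sum>s<n. q ^ (s * (2 * n + 1)) * O' s * E s n)
        + (\<Sum>s<n. v (Suc s) - v s) + q ^ (n * (2 * Suc n + 1)) * O' n * (1 - q ^ (2 * n + 2))"
  proof -
    have "(\<Sum>s<n. q ^ (s * (2 * Suc n + 1)) * O' s * E s (Suc n))
      = (\<Sum>s<n. (1 - q ^ (2 * n + 1)) * (q ^ (s * (2 * n + 1)) * O' s * E s n) + (v (Suc s) - v s))"
      by (intro sum.cong refl step) simp
    then show ?thesis
      by (simp only: sum.lessThan_Suc ES[OF order_refl] E_refl sum.distrib sum_distrib_left mult_1_left)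
  qed
  also have "(\<Sum>s<n. v (Suc s) - v s) = v n - v 0"
    by (rule sum_lessThan_telescope)
  also have "v 0 = 0" by (simp add: v_def)
  also have "v n = q ^ (n * (2 * n + 1)) * (1 - q ^ (2 * n)) * O' n" by (simp add: v_def E_refl)
  also have "q ^ (n * (2 * Suc n + 1)) = q ^ (n * (2 * n + 1)) * q ^ (2 * n)" by (rule pw)
  finally have R: "(\<Sum>s<Suc n. q ^ (s * (2 * Suc n + 1)) * O' s * E s (Suc n))
     = (1 - q ^ (2 * n + 1)) * (\<Sum>s<n. q ^ (s * (2 * n + 1)) * O' s * E s n)
        + (q ^ (n * (2 * n + 1)) * (1 - q ^ (2 * n)) * O' n - 0)
        + q ^ (n * (2 * n + 1)) * q ^ (2 * n) * O' n * (1 - q ^ (2 * n + 2))" .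
  have t: "2 * n * (2 * n + 1) div 2 = n * (2 * n + 1)"
    "Suc (2 * n) * (Suc (2 * n) + 1) div 2 = n * (2 * n + 1) + (2 * n + 1)"
    by (simp_all add: algebra_simps)
  have "(\<Sum>s<2 * Suc n. q ^ (s * (s + 1) div 2))
      = (\<Sum>s<2 * n. q ^ (s * (s + 1) div 2)) + q ^ (n * (2 * n + 1)) + q ^ (n * (2 * n + 1)) * q ^ (2 * n + 1)"
    by (simp only: mult_Suc_right add_2_eq_Suc sum.lessThan_Suc t power_add[symmetric])
  then have "O' (Suc n) * (\<Sum>s<2 * Suc n. q ^ (s * (s + 1) div 2))
      = (1 - q ^ (2 * n + 1)) * (O' n * (\<Sum>s<2 * n. q ^ (s * (s + 1) div 2)))
       + O' n * (1 - q ^ (2 * n + 1)) * q ^ (n * (2 * n + 1)) * (1 + q ^ (2 * n + 1))"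
    by (simp only: OS) (simp only: algebra_simps mult_1_left mult_1_right)
  also have "\<dots> = (\<Sum>s<Suc n. q ^ (s * (2 * Suc n + 1)) * O' s * E s (Suc n))"
  proof -
    have "q ^ (2 * n + 2) = q ^ (2 * n) * (q * q)" "q ^ (2 * n + 1) = q ^ (2 * n) * q"
      by (simp_all add: power_add)
    then show ?thesis unfolding Suc.IH R by (simp only:) (simp add: algebra_simps)
  qed
  finally show ?case .
qed

section \<open>Truncation, dilation and the Euler operator\<close>

text \<open>Congruence modulo \<open>X^(n + 1)\<close>. Identities between infinite products are read off from finite ones
by comparing both sides up to every degree \<open>n\<close>.\<close>

definition agree :: "nat \<Rightarrow> int fps \<Rightarrow> int fps \<Rightarrow> bool" where
  "agree n f g \<longleftrightarrow> (\<forall>i\<le>n. f $ i = g $ i)"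

lemma agree_refl [simp]: "agree n f f" by (simp add: agree_def)
lemma agree_sym: "agree n f g \<Longrightarrow> agree n g f" by (simp add: agree_def)
lemma agree_trans [trans]: "agree n f g \<Longrightarrow> agree n g h \<Longrightarrow> agree n f h" by (simp add: agree_def)
lemma agree_mono: "agree n f g \<Longrightarrow> m \<le> n \<Longrightarrow> agree m f g" by (simp add: agree_def)
lemma agree_add: "agree n f g \<Longrightarrow> agree n f' g' \<Longrightarrow> agree n (f + f') (g + g')" by (simp add: agree_def)
lemma agree_mult: "agree n f g \<Longrightarrow> agree n f' g' \<Longrightarrow> agree n (f * f') (g * g')"
  by (auto simp: agree_def fps_mult_nth intro!: sum.cong)
lemma agree_uminus: "agree n f g \<Longrightarrow> agree n (- f) (- g)" by (simp add: agree_def)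
lemma fps_eq_agreeI: "(\<And>n. agree n f g) \<Longrightarrow> f = g" by (auto simp: agree_def fps_eq_iff)
lemma agree_X_power: "n < k \<Longrightarrow> agree n (fps_X ^ k * f) 0"
  by (simp add: agree_def fps_X_power_mult_nth)

lemma compose_X_power_nth:
  assumes "0 < m"
  shows "(f oo fps_X ^ m) $ n = (if m dvd n then (f :: int fps) $ (n div m) else 0)"
proof -
  have "(f oo fps_X ^ m) $ n = (\<Sum>i=0..n. f $ i * of_bool (n = m * i))"
    by (simp add: fps_compose_nth power_mult[symmetric] fps_X_power_nth of_bool_def)
  also have "\<dots> = (\<Sum>i\<in>{0..n} \<inter> {i. n = m * i}. f $ i)"
    by (intro sum.mono_neutral_cong_right) auto
  also have "{0..n} \<inter> {i. n = m * i} = (if m dvd n then {n div m} else {})"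
    using assms by auto
  finally show ?thesis by simp
qed

lemma compose_neg_X_nth: "(f oo - fps_X) $ n = (-1) ^ n * (f :: int fps) $ n"
  using fps_compose_uminus'[of f] by simp

lemma agree_compose_X_power:
  "agree n f g \<Longrightarrow> 0 < m \<Longrightarrow> agree n (f oo fps_X ^ m) (g oo fps_X ^ m)"
  unfolding agree_def compose_X_power_nth
  by (metis div_le_dividend le_trans)

lemma agree_compose_neg_X: "agree n f g \<Longrightarrow> agree n (f oo - fps_X) (g oo - fps_X)"
  by (simp add: agree_def compose_neg_X_nth)

text \<open>The operator \<open>q d/dq\<close>. It preserves exponents, and it turns the logarithm of an infinite product into a
divisor series.\<close>

definition qderiv :: "int fps \<Rightarrow> int fps" where "qderiv f = fps_X * fps_deriv f"

lemma qderiv_nth: "qderiv f $ n = int n * f $ n"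
  by (cases n) (simp_all add: qderiv_def)

lemma qderiv_mult: "qderiv (f * g) = qderiv f * g + f * qderiv g"
  by (simp add: qderiv_def algebra_simps)

lemma agree_qderiv: "agree n f g \<Longrightarrow> agree n (qderiv f) (qderiv g)"
  by (simp add: agree_def qderiv_nth)

lemma qderiv_compose_X_power: "0 < m \<Longrightarrow> qderiv (f oo fps_X ^ m) = of_nat m * (qderiv f oo fps_X ^ m)"
  by (rule fps_ext) (auto simp: qderiv_nth compose_X_power_nth fps_of_nat[symmetric] simp del: fps_of_nat)

section \<open>Infinite products\<close>

definition fprod :: "nat set \<Rightarrow> nat \<Rightarrow> int fps" where
  "fprod A n = (\<Prod>k\<in>A \<inter> {1..n}. 1 - fps_X ^ k)"

text \<open>The infinite product of \<open>1 - X^k\<close> over \<open>k \<in> A\<close>. Its coefficient at \<open>n\<close> does not depend on the factors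
beyond \<open>k = n\<close>, so it can be taken from the finite product.\<close>

definition euler_prod :: "nat set \<Rightarrow> int fps" where
  "euler_prod A = Abs_fps (\<lambda>n. fprod A n $ n)"

lemma fprod_Suc: "fprod A (Suc n) = (if Suc n \<in> A then (1 - fps_X ^ Suc n) * fprod A n else fprod A n)"
proof -
  have "A \<inter> {1..Suc n} = (if Suc n \<in> A then insert (Suc n) (A \<inter> {1..n}) else A \<inter> {1..n})"
    by (auto simp: le_Suc_eq)
  then show ?thesis by (auto simp: fprod_def)
qed

lemma agree_fprod_mono: "n \<le> m \<Longrightarrow> agree n (fprod A m) (fprod A n)"
proof (induction m rule: dec_induct)
  case (step m)
  have "agree n (fps_X ^ Suc m * fprod A m) 0"
    using step by (intro agree_X_power) auto
  then have "agree n (fprod A (Suc m)) (fprod A m)"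
    by (auto simp: fprod_Suc agree_def left_diff_distrib simp del: power_Suc)
  then show ?case using step.IH agree_trans by blast
qed simp

lemma agree_euler_prod: "agree n (euler_prod A) (fprod A n)"
  unfolding agree_def
proof (intro allI impI)
  fix i assume "i \<le> n"
  then have "agree i (fprod A n) (fprod A i)" by (rule agree_fprod_mono)
  then show "euler_prod A $ i = fprod A n $ i" by (simp add: agree_def euler_prod_def)
qed

lemma euler_prod_eqI: "(\<And>n. agree n f (fprod A n)) \<Longrightarrow> f = euler_prod A"
  by (meson agree_euler_prod agree_sym agree_trans fps_eq_agreeI)

lemma euler_prod_nth_0 [simp]: "euler_prod A $ 0 = 1"
  by (simp add: euler_prod_def fprod_def)

lemma euler_prod_nz [simp]: "euler_prod A \<noteq> 0"
  using euler_prod_nth_0[of A] by (metis fps_zero_nth zero_neq_one)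

lemma euler_prod_Un:
  assumes "A \<inter> B = {}"
  shows "euler_prod (A \<union> B) = euler_prod A * euler_prod B"
proof (rule euler_prod_eqI[symmetric])
  fix n
  have "fprod (A \<union> B) n = fprod A n * fprod B n"
    unfolding fprod_def Int_Un_distrib2 using assms by (intro prod.union_disjoint) auto
  then show "agree n (euler_prod A * euler_prod B) (fprod (A \<union> B) n)"
    by (simp add: agree_mult agree_euler_prod)
qed

lemma euler_prod_compose_X_power:
  assumes "0 < m"
  shows "euler_prod A oo fps_X ^ m = euler_prod ((*) m ` A)"
proof (rule euler_prod_eqI)
  fix n
  have "fprod A n oo fps_X ^ m = (\<Prod>k\<in>A \<inter> {1..n}. 1 - fps_X ^ (m * k))"
    unfolding fprod_def using assms
    by (simp add: fps_compose_prod_distrib fps_compose_sub_distrib fps_compose_power[symmetric] power_mult)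
  also have "\<dots> = fprod ((*) m ` A) (m * n)"
    unfolding fprod_def using assms
    by (intro prod.reindex_cong[of "(*) m", symmetric] inj_onI) auto
  finally have "agree n (euler_prod A oo fps_X ^ m) (fprod ((*) m ` A) (m * n))"
    using agree_compose_X_power[OF agree_euler_prod assms, of n A] by simp
  then show "agree n (euler_prod A oo fps_X ^ m) (fprod ((*) m ` A) n)"
    by (rule agree_trans[OF _ agree_fprod_mono]) (use assms in simp)
qed

abbreviation "odds \<equiv> {k::nat. odd k}"
abbreviation "evens \<equiv> {k::nat. even k}"

text \<open>Replacing \<open>X\<close> by \<open>-X\<close> turns \<open>1 - X^k\<close> into \<open>1 + X^k\<close> for odd \<open>k\<close>, and the two multiply to
\<open>1 - X^(2 k)\<close>.\<close>

lemma euler_prod_odds_neg: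
  "euler_prod odds * (euler_prod odds oo - fps_X) = euler_prod odds oo fps_X ^ 2"
proof (rule fps_eq_agreeI)
  fix n
  have "fprod odds n oo - fps_X = (\<Prod>k\<in>odds \<inter> {1..n}. 1 + fps_X ^ k)"
    unfolding fprod_def
    by (auto simp: fps_compose_prod_distrib fps_compose_sub_distrib fps_compose_power[symmetric] intro!: prod.cong)
  then have "fprod odds n * (fprod odds n oo - fps_X) = (\<Prod>k\<in>odds \<inter> {1..n}. (1 - fps_X ^ k) * (1 + fps_X ^ k))"
    by (simp add: fprod_def prod.distrib)
  also have "\<dots> = fprod odds n oo fps_X ^ 2"
    unfolding fprod_def
    by (auto simp: fps_compose_prod_distrib fps_compose_sub_distrib fps_compose_power[symmetric]
         algebra_simps power_add[symmetric] mult_2 power_mult[symmetric] intro!: prod.cong)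
  finally have "fprod odds n * (fprod odds n oo - fps_X) = fprod odds n oo fps_X ^ 2" .
  then show "agree n (euler_prod odds * (euler_prod odds oo - fps_X)) (euler_prod odds oo fps_X ^ 2)"
    using agree_mult[OF agree_euler_prod agree_compose_neg_X[OF agree_euler_prod], of n odds odds]
      agree_sym[OF agree_compose_X_power[OF agree_euler_prod, of 2 n odds]]
    by (simp only:) (rule agree_trans, assumption, simp)
qed

text \<open>The Lambert series of \<open>u\<close>: the coefficient at \<open>n\<close> sums \<open>u d e\<close> over the factorizations \<open>n = d e\<close> into
positive factors. The condition \<open>0 < n\<close> keeps the constant term at 0, where every \<open>d\<close> would be a divisor.\<close>

definition divisor_series :: "(nat \<Rightarrow> nat \<Rightarrow> int) \<Rightarrow> int fps" where
  "divisor_series u = Abs_fps (\<lambda>n. \<Sum>d | d dvd n \<and> 0 < n. u d (n div d))"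

text \<open>The logarithmic derivative: \<open>X^k = (1 - X^k) G k\<close> with \<open>G k\<close> the geometric series, so each factor
contributes \<open>- k G k\<close>.\<close>

lemma qderiv_euler_prod:
  "qderiv (euler_prod A) = - euler_prod A * divisor_series (\<lambda>d e. if d \<in> A then int d else 0)"
proof (rule fps_eq_agreeI)
  fix n
  define G where "G k = Abs_fps (\<lambda>i. if k dvd i \<and> 0 < i then 1 else 0 :: int)" for k :: nat
  have G: "fps_X ^ k = (1 - fps_X ^ k) * G k" if "0 < k" for k
  proof (rule fps_ext)
    fix i show "fps_X ^ k $ i = ((1 - fps_X ^ k) * G k) $ i"
      using that by (auto simp: left_diff_distrib fps_X_power_mult_nth fps_X_power_nth G_def dvd_minus_self dest: dvd_imp_le dvd_diffD)
  qed
  have th: "qderiv (1 - fps_X ^ k) = - (1 - fps_X ^ k) * (of_nat k * G k)" if "0 < k" for k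
  proof -
    have "qderiv (1 - fps_X ^ k) = - of_nat k * fps_X ^ k"
      by (rule fps_ext) (auto simp: qderiv_nth fps_of_nat[symmetric] fps_X_power_nth that simp del: fps_of_nat)
    also have "\<dots> = - (1 - fps_X ^ k) * (of_nat k * G k)"
      by (subst G[OF that]) (simp add: algebra_simps)
    finally show ?thesis .
  qed
  have "qderiv (\<Prod>k\<in>S. 1 - fps_X ^ k) = - (\<Prod>k\<in>S. 1 - fps_X ^ k) * (\<Sum>k\<in>S. of_nat k * G k)"
    if "finite S" "0 \<notin> S" for S
    using that
  proof (induction S rule: finite_induct)
    case empty
    show ?case by (rule fps_ext) (simp add: qderiv_nth)
  next
    case (insert k S)
    then have "0 < k" "0 \<notin> S" by auto
    then show ?case
      unfolding prod.insert[OF insert(1,2)] sum.insert[OF insert(1,2)] qderiv_mult th[OF \<open>0 < k\<close>] insert(3)[OF \<open>0 \<notin> S\<close>]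
      by (simp add: algebra_simps)
  qed
  then have "qderiv (fprod A n) = - fprod A n * (\<Sum>k\<in>A \<inter> {1..n}. of_nat k * G k)"
    unfolding fprod_def by simp
  moreover have "agree n (\<Sum>k\<in>A \<inter> {1..n}. of_nat k * G k) (divisor_series (\<lambda>d e. if d \<in> A then int d else 0))"
    unfolding agree_def
  proof (intro allI impI)
    fix i assume i: "i \<le> n"
    have "(\<Sum>k\<in>A \<inter> {1..n}. of_nat k * G k) $ i = (\<Sum>k\<in>A \<inter> {1..n}. if k dvd i \<and> 0 < i then int k else 0)"
      by (simp add: fps_sum_nth G_def fps_of_nat[symmetric] del: fps_of_nat)
         (auto intro!: sum.cong)
    also have "\<dots> = (\<Sum>k | k dvd i \<and> 0 < i. if k \<in> A then int k else 0)"
      using i by (intro sum.mono_neutral_cong) (auto dest: dvd_imp_le simp: Suc_le_eq intro!: Nat.gr0I)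
    finally show "(\<Sum>k\<in>A \<inter> {1..n}. of_nat k * G k) $ i = divisor_series (\<lambda>d e. if d \<in> A then int d else 0) $ i"
      by (simp add: divisor_series_def)
  qed
  ultimately have "agree n (qderiv (fprod A n)) (- euler_prod A * divisor_series (\<lambda>d e. if d \<in> A then int d else 0))"
    by (simp only:) (rule agree_mult[OF agree_uminus[OF agree_sym[OF agree_euler_prod]]])
  with agree_qderiv[OF agree_euler_prod]
  show "agree n (qderiv (euler_prod A)) (- euler_prod A * divisor_series (\<lambda>d e. if d \<in> A then int d else 0))"
    by (rule agree_trans)
qed

section \<open>The theta series of squares and of triangular numbers\<close>

definition phi :: "int fps" where
  "phi = Abs_fps (\<lambda>n. if n = 0 then 1 else if \<exists>i. n = i\<^sup>2 then 2 else 0)"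

definition psi :: "int fps" where
  "psi = Abs_fps (\<lambda>n. if \<exists>k. n = k * (k + 1) div 2 then 1 else 0)"

lemma phi_nth: "phi $ n = (if n = 0 then 1 else if \<exists>i. n = i\<^sup>2 then 2 else 0)"
  by (simp add: phi_def)

lemma psi_nth: "psi $ n = (if \<exists>k. n = k * (k + 1) div 2 then 1 else 0)"
  by (simp add: psi_def)

lemma fps_X_power_nth_of_bool: "(fps_X ^ k :: int fps) $ n = of_bool (n = k)"
  by (simp add: fps_X_power_nth)

lemma agree_phi_neg: "agree n (phi oo - fps_X) (1 + 2 * (\<Sum>s<n. (-1) ^ Suc s * fps_X ^ (Suc s)\<^sup>2))"
  unfolding agree_def
proof (intro allI impI)
  fix i assume i: "i \<le> n"
  have c: "((-1) ^ Suc s * fps_X ^ (Suc s)\<^sup>2 :: int fps) $ i = (if i = (Suc s)\<^sup>2 then (-1) ^ i else 0)" for s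
  proof -
    have "((-1) ^ Suc s :: int fps) = fps_const ((-1) ^ Suc s)"
      by (simp flip: fps_const_power fps_const_neg add: fps_const_1_eq_1)
    moreover have "((-1) ^ Suc s :: int) = (-1) ^ (Suc s)\<^sup>2"
      by (simp add: minus_one_power_iff del: power_Suc)
    ultimately show ?thesis by (simp add: fps_X_power_nth del: power_Suc)
  qed
  have "(\<Sum>s<n. if i = (Suc s)\<^sup>2 then (-1) ^ i else 0 :: int) = (if 0 < i \<and> (\<exists>j. i = j\<^sup>2) then (-1) ^ i else 0)"
  proof (cases "0 < i \<and> (\<exists>j. i = j\<^sup>2)")
    case True
    then obtain j where j: "i = j\<^sup>2" by auto
    with True obtain s where s: "j = Suc s" by (cases j) auto
    have "Suc s \<le> i" unfolding j s by (simp add: power2_eq_square)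
    then have "(\<Sum>s<n. if i = (Suc s)\<^sup>2 then (-1) ^ i else 0 :: int) = (\<Sum>t\<in>{s}. (-1) ^ i)"
      using i by (intro sum.mono_neutral_cong_right) (auto simp: j s)
    then show ?thesis using True by simp
  next
    case False
    then have "i \<noteq> (Suc s)\<^sup>2" for s by auto
    then show ?thesis using False by simp
  qed
  then have "(1 + 2 * (\<Sum>s<n. (-1) ^ Suc s * fps_X ^ (Suc s)\<^sup>2) :: int fps) $ i =
     of_bool (i = 0) + 2 * (if 0 < i \<and> (\<exists>j. i = j\<^sup>2) then (-1) ^ i else 0)"
    by (simp only: fps_add_nth fps_sum_nth c mult_2) simp
  then show "(phi oo - fps_X) $ i = (1 + 2 * (\<Sum>s<n. (-1) ^ Suc s * fps_X ^ (Suc s)\<^sup>2)) $ i"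
    by (auto simp: compose_neg_X_nth phi_nth)
qed

lemma agree_psi: "agree n psi (\<Sum>s<2 * Suc n. fps_X ^ (s * (s + 1) div 2))"
  unfolding agree_def
proof (intro allI impI)
  fix i assume i: "i \<le> n"
  have inj: "s = t" if "s * (s + 1) div 2 = t * (t + 1) div (2::nat)" for s t :: nat
  proof -
    have "2 * (s * (s + 1) div 2) = s * (s + 1)" for s :: nat by (rule dvd_mult_div_cancel) simp
    then have "s * (s + 1) = t * (t + 1)" using that by metis
    moreover have "s * (s + 1) < t * (t + 1)" if "s < t" for s t :: nat
      using that by (intro mult_strict_mono) auto
    ultimately show ?thesis by (cases s t rule: linorder_cases) fastforce+
  qed
  show "psi $ i = (\<Sum>s<2 * Suc n. fps_X ^ (s * (s + 1) div 2)) $ i"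
  proof (cases "\<exists>k. i = k * (k + 1) div 2")
    case True
    then obtain k where k: "i = k * (k + 1) div 2" by blast
    have iff: "i = s * (s + 1) div 2 \<longleftrightarrow> s = k" for s
      using inj[of s k] k by metis
    have "k * 2 \<le> k * (k + 1)" by (cases k) auto
    then have "k \<le> i" unfolding k by (simp add: less_eq_div_iff_mult_less_eq)
    then show ?thesis using True i
      by (simp only: fps_sum_nth fps_X_power_nth_of_bool psi_nth iff) simp
  next
    case False
    then have "i \<noteq> s * (s + 1) div 2" for s by blast
    then show ?thesis using False by (simp only: fps_sum_nth fps_X_power_nth_of_bool psi_nth) simp
  qed
qed

lemma fprod_UNIV: "fprod UNIV n = (\<Prod>k<n. 1 - fps_X ^ Suc k)"
  by (simp add: fprod_def prod.atLeast1_atMost_eq)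

lemma fprod_odds: "fprod odds (2 * m) = (\<Prod>k<m. 1 - fps_X ^ (2 * k + 1))"
  unfolding fprod_def
  by (rule prod.reindex_bij_witness[where i = "\<lambda>k. 2 * k + 1" and j = "\<lambda>k. k div 2"]) (auto elim!: oddE)

lemma fprod_evens: "fprod evens (2 * m) = (\<Prod>k<m. 1 - fps_X ^ (2 * k + 2))"
  unfolding fprod_def
  by (rule prod.reindex_bij_witness[symmetric, where j = "\<lambda>k. 2 * k + 2" and i = "\<lambda>k. k div 2 - 1"]) (auto elim!: evenE)

lemma agree_sum_0: "(\<And>s. s \<in> S \<Longrightarrow> agree n (f s) 0) \<Longrightarrow> agree n (sum f S) 0"
  by (simp add: agree_def fps_sum_nth)

lemma evens_eq: "evens = (*) 2 ` UNIV" by (auto elim: evenE)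

text \<open>Gauss: \<open>phi(-q)\<close> is the product of \<open>(1 - q^k) / (1 + q^k)\<close>; multiplying by the product of
\<open>1 - q^(2 k) = (1 - q^k) (1 + q^k)\<close> leaves a square.\<close>

lemma phi_neg_euler_prod: "(phi oo - fps_X) * euler_prod evens = euler_prod UNIV * euler_prod UNIV"
proof (rule fps_eq_agreeI)
  fix n
  define D :: "nat \<Rightarrow> int fps" where "D n = (\<Prod>k<n. 1 + fps_X ^ Suc k)" for n
  define N :: "nat \<Rightarrow> nat \<Rightarrow> int fps" where "N s n = (\<Prod>k=s..<n. 1 - fps_X ^ Suc k)" for s n
  define T :: "int fps" where "T = 1 + 2 * (\<Sum>s<n. (-1) ^ Suc s * fps_X ^ (Suc s)\<^sup>2)"
  have N: "N 0 n = fprod UNIV n" by (simp add: N_def fprod_UNIV atLeast0LessThan)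
  have "N 0 n * D n = (\<Prod>k<n. (1 - fps_X ^ Suc k) * (1 + fps_X ^ Suc k))"
    by (simp add: N_def D_def prod.distrib atLeast0LessThan)
  also have "\<dots> = fprod UNIV n oo fps_X ^ 2"
    unfolding fprod_UNIV
    by (auto simp: fps_compose_prod_distrib fps_compose_sub_distrib fps_compose_power[symmetric]
         algebra_simps power_add[symmetric] mult_2 power_mult[symmetric] simp del: power_Suc intro!: prod.cong)
  finally have ND: "agree n (euler_prod evens) (N 0 n * D n)"
    unfolding evens_eq euler_prod_compose_X_power[OF zero_less_numeral, symmetric]
    by (simp add: agree_compose_X_power agree_euler_prod)
  have "agree n ((-1) ^ Suc s * fps_X ^ (Suc s * Suc n) * D s * N (Suc s) n) 0" for s
    using agree_X_power[of n "Suc s * Suc n" "(-1) ^ Suc s * D s * N (Suc s) n"] by (simp add: mult_ac)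
  then have "agree n (N 0 n + 2 * (\<Sum>s<n. (-1) ^ Suc s * fps_X ^ (Suc s * Suc n) * D s * N (Suc s) n)) (N 0 n + 2 * 0)"
    by (intro agree_add agree_mult agree_refl agree_sum_0)
  moreover have "D n * T = N 0 n + 2 * (\<Sum>s<n. (-1) ^ Suc s * fps_X ^ (Suc s * Suc n) * D s * N (Suc s) n)"
    unfolding D_def N_def T_def by (rule shanks_phi)
  ultimately have DT: "agree n (D n * T) (fprod UNIV n)" by (simp add: N)
  have "agree n ((phi oo - fps_X) * euler_prod evens) (T * (N 0 n * D n))"
    using agree_phi_neg[of n] ND by (intro agree_mult) (simp_all add: T_def)
  also have "T * (N 0 n * D n) = fprod UNIV n * (D n * T)" by (simp add: N mult_ac)
  also have "agree n \<dots> (fprod UNIV n * fprod UNIV n)"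
    by (intro agree_mult DT agree_refl)
  also have "agree n \<dots> (euler_prod UNIV * euler_prod UNIV)"
    by (intro agree_mult agree_sym[OF agree_euler_prod])
  finally show "agree n ((phi oo - fps_X) * euler_prod evens) (euler_prod UNIV * euler_prod UNIV)" .
qed

lemma psi_euler_prod: "psi * euler_prod odds = euler_prod evens"
proof (rule fps_eq_agreeI)
  fix n
  define D :: "nat \<Rightarrow> int fps" where "D n = (\<Prod>k<n. 1 - fps_X ^ (2 * k + 1))" for n
  define E :: "nat \<Rightarrow> nat \<Rightarrow> int fps" where "E s n = (\<Prod>k=s..<n. 1 - fps_X ^ (2 * k + 2))" for s n
  define S :: "int fps" where "S = (\<Sum>s<2 * Suc n. fps_X ^ (s * (s + 1) div 2))"
  have D: "agree n (euler_prod odds) (D (Suc n))"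
    using agree_mono[OF agree_euler_prod, of n "2 * Suc n" odds] unfolding D_def fprod_odds by simp
  have E: "agree n (euler_prod evens) (E 0 (Suc n))"
    using agree_mono[OF agree_euler_prod, of n "2 * Suc n" evens] unfolding E_def fprod_evens by (simp add: atLeast0LessThan)
  have "D (Suc n) * S = (\<Sum>s<Suc n. fps_X ^ (s * (2 * Suc n + 1)) * D s * E s (Suc n))"
    unfolding D_def E_def S_def by (rule shanks_psi)
  also have "\<dots> = E 0 (Suc n) + (\<Sum>s<n. fps_X ^ (Suc s * (2 * Suc n + 1)) * D (Suc s) * E (Suc s) (Suc n))"
    by (subst sum.lessThan_Suc_shift) (simp add: D_def)
  also have "agree n \<dots> (E 0 (Suc n) + 0)"
  proof (intro agree_add agree_refl agree_sum_0)
    fix s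
    have "n < Suc s * (2 * Suc n + 1)" by simp
    then show "agree n (fps_X ^ (Suc s * (2 * Suc n + 1)) * D (Suc s) * E (Suc s) (Suc n)) 0"
      unfolding mult.assoc by (rule agree_X_power)
  qed
  finally have "agree n (S * D (Suc n)) (E 0 (Suc n))" by (simp add: mult.commute)
  moreover have "agree n (psi * euler_prod odds) (S * D (Suc n))"
    unfolding S_def by (intro agree_mult agree_psi D)
  ultimately show "agree n (psi * euler_prod odds) (euler_prod evens)"
    using E agree_sym agree_trans by meson
qed

lemma neg_X_compose_X_power_even: "(f oo fps_X ^ 2) oo - fps_X = (f :: int fps) oo fps_X ^ 2"
  by (rule fps_ext) (auto simp: compose_neg_X_nth compose_X_power_nth)

lemma neg_X_neg_X: "(f oo - fps_X) oo - fps_X = (f :: int fps)"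
  by (rule fps_ext) (simp add: compose_neg_X_nth power_add[symmetric])

lemma compose_neg_X_mult: "(f * g) oo - fps_X = (f oo - fps_X) * ((g :: int fps) oo - fps_X)"
  by (simp add: fps_compose_mult_distrib)

lemma compose_X_power_mult: "0 < m \<Longrightarrow> (f * g) oo fps_X ^ m = (f oo fps_X ^ m) * ((g :: int fps) oo fps_X ^ m)"
  by (simp add: fps_compose_mult_distrib)

abbreviation "fours \<equiv> {k::nat. 4 dvd k}"

lemma evens_compose: "euler_prod evens oo fps_X ^ 2 = euler_prod fours"
proof -
  have "(*) 2 ` evens = fours" by (auto elim!: evenE dvdE)
  then show ?thesis by (simp add: euler_prod_compose_X_power)
qed

lemma evens_split: "euler_prod evens = (euler_prod odds oo fps_X ^ 2) * euler_prod fours"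
proof -
  have "(*) 2 ` odds = {k. k mod 4 = 2}"
  proof (intro set_eqI iffI)
    fix k :: nat assume "k \<in> {k. k mod 4 = 2}"
    then have "k = 2 * (k div 2)" "odd (k div 2)" by (auto, presburger+)
    then show "k \<in> (*) 2 ` odds" by blast
  qed (auto, presburger)
  moreover have "evens = {k. k mod 4 = 2} \<union> fours" by (auto; presburger)
  ultimately show ?thesis
    by (simp add: euler_prod_compose_X_power euler_prod_Un disjoint_iff dvd_eq_mod_eq_0)
qed

lemma UNIV_split: "euler_prod UNIV = euler_prod odds * euler_prod evens"
proof -
  have "UNIV = odds \<union> evens" by auto
  then show ?thesis by (metis (no_types, lifting) disjoint_iff euler_prod_Un mem_Collect_eq)
qed

lemma psi_neg_euler_prod: "(psi oo - fps_X) * (euler_prod odds oo - fps_X) = euler_prod evens"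
proof -
  have "euler_prod evens oo - fps_X = euler_prod evens"
    unfolding evens_eq euler_prod_compose_X_power[OF zero_less_numeral, symmetric]
    by (rule neg_X_compose_X_power_even)
  then show ?thesis by (metis psi_euler_prod compose_neg_X_mult)
qed

lemma psi_dilate_euler_prod: "(psi oo fps_X ^ 2) * (euler_prod odds oo fps_X ^ 2) = euler_prod fours"
  by (simp add: compose_X_power_mult[symmetric] psi_euler_prod evens_compose)

lemma odds_neg_nz: "euler_prod odds oo - fps_X \<noteq> 0"
  by (metis compose_neg_X_mult euler_prod_nz mult_zero_right psi_neg_euler_prod)

lemma odds_dilate_nz: "euler_prod odds oo fps_X ^ 2 \<noteq> 0"
  by (simp add: euler_prod_compose_X_power)

text \<open>Both sides are the same eta quotient. The identity is checked after \<open>q \<mapsto> -q\<close>, where \<open>phi\<close> has the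
simplest product, by multiplying with the denominators of all the products involved and cancelling.\<close>

lemma psi_squared_factorization: "psi * psi = phi * (psi oo fps_X ^ 2)"
proof -
  let ?p = "psi oo - fps_X" and ?h = "phi oo - fps_X" and ?r = "psi oo fps_X ^ 2"
  let ?O = "euler_prod odds" and ?O' = "euler_prod odds oo - fps_X" and ?T = "euler_prod odds oo fps_X ^ 2"
  let ?E = "euler_prod evens" and ?F = "euler_prod fours" and ?N = "euler_prod UNIV"
  have "(?p * ?p) * (?O' * ?O' * ?E * ?T) = (?p * ?O') * (?p * ?O') * ?E * ?T"
    by (simp only: mult_ac)
  also have "\<dots> = ?E * ?E * ?E * ?T" by (simp only: psi_neg_euler_prod)
  also have "\<dots> = ?E * ?E * (?T * ?F) * ?T" by (simp only: evens_split[symmetric])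
  also have "\<dots> = ?E * ?E * (?O * ?O') * (?O * ?O') * ?F" by (simp only: euler_prod_odds_neg mult_ac)
  also have "\<dots> = (?O * ?E) * (?O * ?E) * ?F * (?O' * ?O')" by (simp only: mult_ac)
  also have "\<dots> = (?h * ?E) * (?r * ?T) * (?O' * ?O')"
    by (simp only: UNIV_split[symmetric] phi_neg_euler_prod psi_dilate_euler_prod)
  also have "\<dots> = (?h * ?r) * (?O' * ?O' * ?E * ?T)" by (simp only: mult_ac)
  finally have "?p * ?p = ?h * ?r"
    by (rule mult_right_cancel[THEN iffD1, rotated]) (simp add: odds_neg_nz odds_dilate_nz)
  then have "(?p * ?p) oo - fps_X = (?h * ?r) oo - fps_X" by simp
  then show ?thesis
    by (simp only: compose_neg_X_mult neg_X_neg_X neg_X_compose_X_power_even)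
qed

lemma divisor_series_diff: "divisor_series u - divisor_series v = divisor_series (\<lambda>d e. u d e - v d e)"
  by (rule fps_ext) (simp add: divisor_series_def sum_subtractf)

text \<open>The logarithmic derivative of \<open>\<Prod> (1 - q^(2 k)) / (1 - q^(2 k - 1))\<close>.\<close>

lemma qderiv_psi: "qderiv psi = psi * divisor_series (\<lambda>d e. if odd d then int d else - int d)"
proof -
  let ?O = "euler_prod odds" and ?E = "euler_prod evens"
  let ?o = "divisor_series (\<lambda>d e. if d \<in> odds then int d else 0)"
  let ?e = "divisor_series (\<lambda>d e. if d \<in> evens then int d else 0)"
  have "qderiv psi * ?O + psi * (- ?O * ?o) = - ?E * ?e"
    unfolding qderiv_euler_prod[symmetric] qderiv_mult[symmetric] psi_euler_prod ..
  then have "qderiv psi * ?O = (psi * (?o - ?e)) * ?O"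
    unfolding psi_euler_prod[symmetric] by (simp add: algebra_simps)
  then have "qderiv psi = psi * (?o - ?e)" by simp
  also have "?o - ?e = divisor_series (\<lambda>d e. if odd d then int d else - int d)"
    unfolding divisor_series_diff by (rule arg_cong[where f = divisor_series]) auto
  finally show ?thesis .
qed

section \<open>The generating function of 4-regular partitions\<close>

definition b4_series :: "int fps" where "b4_series = Abs_fps (\<lambda>n. int (b4 n))"

lemma finite_partitions_into: "0 \<notin> A \<Longrightarrow> finite {P. set_mset P \<subseteq> A \<and> sum_mset P = (n::nat)}"
  by (rule finite_subset[OF _ finite_partitions_of[of n]]) (auto simp: partitions_of_def)

text \<open>Adding \<open>k\<close> to the admissible parts multiplies the generating function by \<open>1 / (1 - X^k)\<close>: a partition
without the part \<open>k\<close> is one for the smaller set, and removing one copy of \<open>k\<close> from any other partition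
lowers its sum by \<open>k\<close>.\<close>

lemma partitions_into_series:
  assumes "finite A" "0 \<notin> A"
  shows "Abs_fps (\<lambda>n. int (card {P. set_mset P \<subseteq> A \<and> sum_mset P = (n::nat)})) * (\<Prod>k\<in>A. 1 - fps_X ^ k) = 1"
  using assms
proof (induction A rule: finite_induct)
  case empty
  have "{P. set_mset P \<subseteq> {} \<and> sum_mset P = (n::nat)} = (if n = 0 then {{#}} else {})" for n
    by auto
  then show ?case by (auto simp: fps_eq_iff)
next
  case (insert k A)
  define p where "p B n = {P. set_mset P \<subseteq> B \<and> sum_mset P = (n::nat)}" for B n
  define f where "f B = Abs_fps (\<lambda>n. int (card (p B n)))" for B
  have k: "0 < k" "0 \<notin> A" using insert by auto
  have fin: "finite (p (insert k A) n)" "finite (p A n)" for n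
    unfolding p_def using insert.prems finite_partitions_into by auto
  have "card (p (insert k A) n) = card (p A n) + (if k \<le> n then card (p (insert k A) (n - k)) else 0)" for n
  proof -
    have split: "p (insert k A) n = p A n \<union> {P \<in> p (insert k A) n. k \<in># P}"
      by (auto simp: p_def)
    have "card (p (insert k A) n) = card (p A n) + card {P \<in> p (insert k A) n. k \<in># P}"
    proof (subst split, rule card_Un_disjoint)
      show "p A n \<inter> {P \<in> p (insert k A) n. k \<in># P} = {}"
        using insert.hyps(2) by (auto simp: p_def)
      show "finite {P \<in> p (insert k A) n. k \<in># P}"
        by (rule finite_subset[OF _ fin(1)[of n]]) blast
    qed (rule fin)
    also have "card {P \<in> p (insert k A) n. k \<in># P} = (if k \<le> n then card (p (insert k A) (n - k)) else 0)"
    proof (cases "k \<le> n")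
      case True
      have "bij_betw (add_mset k) (p (insert k A) (n - k)) {P \<in> p (insert k A) n. k \<in># P}"
        using True
        by (intro bij_betwI[where g = "\<lambda>P. P - {#k#}"])
           (auto simp: p_def dest: in_diffD dest!: multi_member_split)
      then show ?thesis using True by (simp add: bij_betw_same_card)
    next
      case False
      then have "{P \<in> p (insert k A) n. k \<in># P} = {}"
        by (auto simp: p_def dest!: multi_member_split)
      then show ?thesis using False by (simp only: card.empty if_False)
    qed
    finally show ?thesis .
  qed
  then have "f (insert k A) * (1 - fps_X ^ k) = f A"
    by (intro fps_ext) (simp add: right_diff_distrib fps_X_power_mult_right_nth f_def)
  then have "f (insert k A) * (\<Prod>k\<in>insert k A. 1 - fps_X ^ k) = f A * (\<Prod>k\<in>A. 1 - fps_X ^ k)"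
    unfolding prod.insert[OF insert.hyps] mult.assoc[symmetric] by simp
  also have "\<dots> = 1" unfolding f_def p_def using insert.IH k by blast
  finally show ?case by (simp only: f_def p_def)
qed

lemma b4_series_euler_prod: "b4_series * euler_prod (- fours) = 1"
proof (rule fps_eq_agreeI)
  fix n
  define A where "A = - fours \<inter> {1..n}"
  let ?f = "Abs_fps (\<lambda>n. int (card {P. set_mset P \<subseteq> A \<and> sum_mset P = (n::nat)}))"
  have "agree n b4_series ?f"
    unfolding agree_def
  proof (intro allI impI)
    fix i assume i: "i \<le> n"
    have "P \<in> partitions_of i \<and> regular 4 P \<longleftrightarrow> set_mset P \<subseteq> A \<and> sum_mset P = i" for P
    proof -
      have "p \<le> n" if "p \<in># P" "sum_mset P = i" for p
        using that i by (auto dest!: multi_member_split)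
      then show ?thesis by (auto simp: partitions_of_def regular_def A_def Suc_le_eq intro: Nat.gr0I)
    qed
    then show "b4_series $ i = ?f $ i" by (simp add: b4_series_def regular_count_def)
  qed
  then have "agree n (b4_series * euler_prod (- fours)) (?f * fprod (- fours) n)"
    by (intro agree_mult agree_euler_prod)
  also have "?f * fprod (- fours) n = 1"
    unfolding fprod_def A_def[symmetric] by (rule partitions_into_series) (auto simp: A_def)
  finally show "agree n (b4_series * euler_prod (- fours)) 1" .
qed

text \<open>All three series are quotients of infinite products. Multiplying out the denominators leaves an identity
that follows from splitting the index sets by their residue modulo 4.\<close>

lemma b4_series_phi_neg: "b4_series * (phi oo - fps_X) = psi oo - fps_X"
proof -
  let ?p = "psi oo - fps_X" and ?h = "phi oo - fps_X"
  let ?O = "euler_prod odds" and ?O' = "euler_prod odds oo - fps_X" and ?T = "euler_prod odds oo fps_X ^ 2"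
  let ?E = "euler_prod evens" and ?F = "euler_prod fours" and ?N = "euler_prod UNIV" and ?U = "euler_prod (- fours)"
  have N: "?N = ?U * ?F"
    using euler_prod_Un[of "- fours" fours] by (simp add: Compl_partition2)
  have "(b4_series * ?h) * (?E * ?O') = b4_series * (?h * ?E) * ?O'" by (simp only: mult_ac)
  also have "\<dots> = b4_series * (?U * ?F * ?N) * ?O'" by (simp only: phi_neg_euler_prod N)
  also have "\<dots> = (b4_series * ?U) * ?F * (?O * ?E) * ?O'" by (simp only: UNIV_split mult_ac)
  also have "\<dots> = ?F * (?O * ?O') * ?E" by (simp only: b4_series_euler_prod mult_1_left mult_ac)
  also have "\<dots> = (?T * ?F) * ?E" by (simp only: euler_prod_odds_neg mult_ac)
  also have "\<dots> = (?p * ?O') * ?E" by (simp only: evens_split[symmetric] psi_neg_euler_prod)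
  also have "\<dots> = ?p * (?E * ?O')" by (simp only: mult_ac)
  finally show ?thesis
    by (rule mult_right_cancel[THEN iffD1, rotated]) (simp add: odds_neg_nz)
qed

section \<open>Liouville's method for a x + b y = M\<close>

definition quads :: "nat \<Rightarrow> (nat \<Rightarrow> nat \<Rightarrow> nat \<Rightarrow> nat \<Rightarrow> bool) \<Rightarrow> (nat \<times> nat \<times> nat \<times> nat) set" where
  "quads M P = {(a, x, b, y). 0 < a \<and> 0 < x \<and> 0 < b \<and> 0 < y \<and> a * x + b * y = M \<and> P a x b y}"

text \<open>The predicate \<open>P\<close> selects regions of the solution set, such as \<open>b < a\<close> or \<open>x < y\<close>, between which
Euclidean steps give bijections.\<close>

definition quad_sum :: "nat \<Rightarrow> (nat \<Rightarrow> nat \<Rightarrow> nat \<Rightarrow> nat \<Rightarrow> bool) \<Rightarrow> (nat \<Rightarrow> nat \<Rightarrow> nat \<Rightarrow> nat \<Rightarrow> int) \<Rightarrow> int" where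
  "quad_sum M P f = (\<Sum>(a, x, b, y) \<in> quads M P. f a x b y)"

lemma quads_iff [simp]:
  "(a, x, b, y) \<in> quads M P \<longleftrightarrow> 0 < a \<and> 0 < x \<and> 0 < b \<and> 0 < y \<and> a * x + b * y = M \<and> P a x b y"
  by (simp add: quads_def)

lemma finite_quads [simp]: "finite (quads M P)"
proof (rule finite_subset)
  have "a \<le> M \<and> x \<le> M \<and> b \<le> M \<and> y \<le> M"
    if "0 < a" "0 < x" "0 < b" "0 < y" "a * x + b * y = M" for a x b y :: nat
  proof -
    have "a * 1 \<le> a * x" "1 * x \<le> a * x" "b * 1 \<le> b * y" "1 * y \<le> b * y"
      using that by (intro mult_le_mono; simp)+
    then show ?thesis using that by linarith
  qed
  then show "quads M P \<subseteq> {..M} \<times> {..M} \<times> {..M} \<times> {..M}" by auto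
qed simp

lemma quad_sum_cong:
  assumes "\<And>a x b y. 0 < a \<Longrightarrow> 0 < x \<Longrightarrow> 0 < b \<Longrightarrow> 0 < y \<Longrightarrow> a * x + b * y = M \<Longrightarrow> P a x b y = Q a x b y"
    and "\<And>a x b y. 0 < a \<Longrightarrow> 0 < x \<Longrightarrow> 0 < b \<Longrightarrow> 0 < y \<Longrightarrow> a * x + b * y = M \<Longrightarrow> Q a x b y \<Longrightarrow> f a x b y = g a x b y"
  shows "quad_sum M P f = quad_sum M Q g"
  unfolding quad_sum_def using assms by (intro sum.cong) (auto simp: quads_def)

lemma quad_sum_reindex:
  assumes "\<And>a x b y. 0 < a \<Longrightarrow> 0 < x \<Longrightarrow> 0 < b \<Longrightarrow> 0 < y \<Longrightarrow> a * x + b * y = M \<Longrightarrow> P a x b y \<Longrightarrow>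
      (case h (a, x, b, y) of (a', x', b', y') \<Rightarrow> 0 < a' \<and> 0 < x' \<and> 0 < b' \<and> 0 < y' \<and>
         a' * x' + b' * y' = K \<and> Q a' x' b' y' \<and> g a' x' b' y' = f a x b y) \<and> k (h (a, x, b, y)) = (a, x, b, y)"
    and "\<And>a x b y. 0 < a \<Longrightarrow> 0 < x \<Longrightarrow> 0 < b \<Longrightarrow> 0 < y \<Longrightarrow> a * x + b * y = K \<Longrightarrow> Q a x b y \<Longrightarrow>
      (case k (a, x, b, y) of (a', x', b', y') \<Rightarrow> 0 < a' \<and> 0 < x' \<and> 0 < b' \<and> 0 < y' \<and>
         a' * x' + b' * y' = M \<and> P a' x' b' y') \<and> h (k (a, x, b, y)) = (a, x, b, y)"
  shows "quad_sum M P f = quad_sum K Q g"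
proof -
  have 1: "h t \<in> quads K Q \<and> k (h t) = t \<and> (case h t of (a, x, b, y) \<Rightarrow> g a x b y) = (case t of (a, x, b, y) \<Rightarrow> f a x b y)"
    if "t \<in> quads M P" for t
  proof -
    obtain a x b y where t: "t = (a, x, b, y)" by (rule prod_cases4)
    obtain a' x' b' y' where h: "h (a, x, b, y) = (a', x', b', y')" by (rule prod_cases4)
    show ?thesis using that assms(1)[of a x b y] by (simp add: t h)
  qed
  have 2: "k t \<in> quads M P \<and> h (k t) = t" if "t \<in> quads K Q" for t
  proof -
    obtain a x b y where t: "t = (a, x, b, y)" by (rule prod_cases4)
    obtain a' x' b' y' where k: "k (a, x, b, y) = (a', x', b', y')" by (rule prod_cases4)
    show ?thesis using that assms(2)[of a x b y] by (simp add: t k)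
  qed
  show ?thesis
    unfolding quad_sum_def
    by (rule sum.reindex_bij_witness[where i = k and j = h]) (simp_all only: 1 2)
qed

lemma quad_sum_swap: "quad_sum M P f = quad_sum M (\<lambda>a x b y. P b y a x) (\<lambda>a x b y. f b y a x)"
  by (rule quad_sum_reindex[where h = "\<lambda>(a, x, b, y). (b, y, a, x)" and k = "\<lambda>(a, x, b, y). (b, y, a, x)"]) auto

text \<open>A step of the Euclidean algorithm: \<open>a x + b y = (a - b) x + b (x + y)\<close> identifies the solutions with
\<open>b < a\<close> with those with \<open>x < y\<close>.\<close>

lemma quad_sum_euclid_step:
  "quad_sum M (\<lambda>a x b y. b < a) f = quad_sum M (\<lambda>a x b y. x < y) (\<lambda>a x b y. f (a + b) x b (y - x))"
  by (rule quad_sum_reindex[where h = "\<lambda>(a, x, b, y). (a - b, x, b, x + y)"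
        and k = "\<lambda>(a, x, b, y). (a + b, x, b, y - x)"])
     (auto dest!: less_imp_Suc_add simp: algebra_simps)

lemma quad_sum_euclid_step':
  "quad_sum M (\<lambda>a x b y. x < y) f = quad_sum M (\<lambda>a x b y. b < a) (\<lambda>a x b y. f (a - b) x b (x + y))"
  by (subst quad_sum_euclid_step) (rule quad_sum_cong, auto)

text \<open>The rewriting \<open>a x + b y = a (x + y) + (b - a) y\<close> keeps \<open>a\<close> and \<open>y\<close> fixed. By it the solutions with
\<open>a < b\<close> correspond to those with \<open>y < x\<close>, and so, for an invariant \<open>g\<close>, the complementary sums over
\<open>b \<le> a\<close> and over \<open>x \<le> y\<close> agree.\<close>

lemma quad_sum_chain_step:
  assumes "\<And>a x b y. a < b \<Longrightarrow> g a (x + y) (b - a) y = g a x b y"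
  shows "quad_sum M (\<lambda>a x b y. a < b) g = quad_sum M (\<lambda>a x b y. y < x) g"
  by (rule quad_sum_reindex[where h = "\<lambda>(a, x, b, y). (a, x + y, b - a, y)"
        and k = "\<lambda>(a, x, b, y). (a, x - y, a + b, y)"])
     (auto simp: assms, auto dest!: less_imp_Suc_add simp: algebra_simps)

lemma quad_sum_split:
  assumes "\<And>a x b y. \<not> (P a x b y \<and> Q a x b y)"
  shows "quad_sum M (\<lambda>a x b y. P a x b y \<or> Q a x b y) f = quad_sum M P f + quad_sum M Q f"
  unfolding quad_sum_def
proof (subst sum.union_disjoint[symmetric])
  show "quads M P \<inter> quads M Q = {}" using assms by (auto simp: quads_def)
qed (rule finite_quads, rule finite_quads, auto simp: quads_def intro!: sum.cong)

lemma quad_sum_trichotomy_ab: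
  "quad_sum M (\<lambda>a x b y. True) f = quad_sum M (\<lambda>a x b y. b < a) f + quad_sum M (\<lambda>a x b y. a < b) f + quad_sum M (\<lambda>a x b y. a = b) f"
proof -
  have "quad_sum M (\<lambda>a x b y. True) f = quad_sum M (\<lambda>a x b y. (b < a \<or> a < b) \<or> a = b) f"
    by (rule quad_sum_cong) auto
  then show ?thesis by (simp add: quad_sum_split)
qed

lemma quad_sum_trichotomy_xy:
  "quad_sum M (\<lambda>a x b y. True) f = quad_sum M (\<lambda>a x b y. x < y) f + quad_sum M (\<lambda>a x b y. y < x) f + quad_sum M (\<lambda>a x b y. x = y) f"
proof -
  have "quad_sum M (\<lambda>a x b y. True) f = quad_sum M (\<lambda>a x b y. (x < y \<or> y < x) \<or> x = y) f"
    by (rule quad_sum_cong) auto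
  then show ?thesis by (simp add: quad_sum_split)
qed

lemma quad_sum_add: "quad_sum M P (\<lambda>a x b y. f a x b y + g a x b y) = quad_sum M P f + quad_sum M P g"
  unfolding quad_sum_def sum.distrib[symmetric] by (intro sum.cong) auto

lemma quad_sum_diff: "quad_sum M P (\<lambda>a x b y. f a x b y - g a x b y) = quad_sum M P f - quad_sum M P g"
  unfolding quad_sum_def sum_subtractf[symmetric] by (intro sum.cong) auto

lemma quad_sum_cmult: "quad_sum M P (\<lambda>a x b y. c * f a x b y) = c * quad_sum M P f"
  unfolding quad_sum_def sum_distrib_left by (intro sum.cong) auto

text \<open>Liouville's method, for a weight \<open>w\<close> that depends on parities. In the sum of \<open>w F(a - b)\<close> over
\<open>a \<noteq> b\<close> a Euclidean step makes \<open>\<bar>a - b\<bar>\<close> the new \<open>a\<close>, and the sum becomes one of \<open>g F(a)\<close> over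
\<open>x < y\<close>. In the sum of \<open>w F(a + b)\<close> over \<open>x \<noteq> y\<close> the inverse step makes \<open>a + b\<close> the new \<open>a\<close>, and gives the
sum of the same \<open>g F(a)\<close> over \<open>b < a\<close>. By \<open>quad_sum_chain_step\<close> these cancel, except for the diagonals
\<open>a = b\<close> and \<open>x = y\<close>. On a diagonal the equation factors, so what remains are divisor sums.\<close>

lemma liouville_parity:
  fixes F :: "int \<Rightarrow> int" and w :: "bool \<Rightarrow> bool \<Rightarrow> bool \<Rightarrow> bool \<Rightarrow> int"
  defines "g \<equiv> (\<lambda>p q r s. w (p \<noteq> r) q r (q \<noteq> s) + w r (q \<noteq> s) (p \<noteq> r) q)"
  assumes even_F: "\<And>c. F (- c) = F c"
    and inv: "\<And>p q r s. g p (q \<noteq> s) (p \<noteq> r) s = g p q r s"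
  shows "quad_sum M (\<lambda>a x b y. True) (\<lambda>a x b y. w (odd a) (odd x) (odd b) (odd y) * (F (int a - int b) - F (int a + int b)))
    = quad_sum M (\<lambda>a x b y. a = b) (\<lambda>a x b y. w (odd a) (odd x) (odd b) (odd y) * F 0 + g (odd a) (odd x) (odd b) (odd y) * F (int a))
    - quad_sum M (\<lambda>a x b y. x = y) (\<lambda>a x b y. w (odd a) (odd x) (odd b) (odd y) * F (int a + int b) + g (odd a) (odd x) (odd b) (odd y) * F (int a))"
proof -
  let ?w = "\<lambda>a x b y. w (odd a) (odd x) (odd b) (odd y)"
  let ?g = "\<lambda>a x b y. g (odd a) (odd x) (odd b) (odd y) * F (int a)"
  let ?m = "\<lambda>a x b y. ?w a x b y * F (int a - int b)"
  let ?p = "\<lambda>a x b y. ?w a x b y * F (int a + int b)"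
  \<comment> \<open>both regions off the diagonal end up in \<open>x < y\<close>, with \<open>\<bar>a - b\<bar>\<close> in place of \<open>a\<close>\<close>
  have m: "quad_sum M (\<lambda>a x b y. b < a) ?m + quad_sum M (\<lambda>a x b y. a < b) ?m = quad_sum M (\<lambda>a x b y. x < y) ?g"
    unfolding quad_sum_swap[of M "\<lambda>a x b y. a < b"] quad_sum_euclid_step quad_sum_add[symmetric]
  proof (rule quad_sum_cong, goal_cases)
    case (2 a x b y)
    have "F (int b - int (a + b)) = F (int a)" using even_F[of "int a"] by simp
    then show ?case using 2 by (simp add: g_def algebra_simps)
  qed simp
  \<comment> \<open>both regions off the diagonal end up in \<open>b < a\<close>, with \<open>a + b\<close> in place of \<open>a\<close>\<close>
  have p: "quad_sum M (\<lambda>a x b y. x < y) ?p + quad_sum M (\<lambda>a x b y. y < x) ?p = quad_sum M (\<lambda>a x b y. b < a) ?g"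
    unfolding quad_sum_swap[of M "\<lambda>a x b y. y < x"] quad_sum_euclid_step' quad_sum_add[symmetric]
    by (rule quad_sum_cong) (auto simp: g_def algebra_simps of_nat_diff)
  have "quad_sum M (\<lambda>a x b y. a < b) ?g = quad_sum M (\<lambda>a x b y. y < x) ?g"
  proof (rule quad_sum_chain_step)
    fix a x b y :: nat assume "a < b"
    then show "?g a (x + y) (b - a) y = ?g a x b y"
      using inv[of "odd a" "odd x" "odd y" "odd b"]
      by (cases "even a"; cases "even b"; cases "even x"; cases "even y") simp_all
  qed
  with quad_sum_trichotomy_ab[of M ?g] quad_sum_trichotomy_xy[of M ?g]
  have g: "quad_sum M (\<lambda>a x b y. x < y) ?g - quad_sum M (\<lambda>a x b y. b < a) ?g
      = quad_sum M (\<lambda>a x b y. a = b) ?g - quad_sum M (\<lambda>a x b y. x = y) ?g" by simp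
  have "quad_sum M (\<lambda>a x b y. True) (\<lambda>a x b y. ?w a x b y * (F (int a - int b) - F (int a + int b)))
      = quad_sum M (\<lambda>a x b y. True) ?m - quad_sum M (\<lambda>a x b y. True) ?p"
    by (simp add: quad_sum_diff[symmetric] algebra_simps)
  also have "\<dots> = quad_sum M (\<lambda>a x b y. a = b) ?m + quad_sum M (\<lambda>a x b y. a = b) ?g
      - (quad_sum M (\<lambda>a x b y. x = y) ?p + quad_sum M (\<lambda>a x b y. x = y) ?g)"
    using m p g quad_sum_trichotomy_ab[of M ?m] quad_sum_trichotomy_xy[of M ?p] by simp
  also have "quad_sum M (\<lambda>a x b y. a = b) ?m + quad_sum M (\<lambda>a x b y. a = b) ?g
     = quad_sum M (\<lambda>a x b y. a = b) (\<lambda>a x b y. ?w a x b y * F 0 + ?g a x b y)"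
    unfolding quad_sum_add[symmetric] by (rule quad_sum_cong) auto
  finally show ?thesis by (simp add: quad_sum_add)
qed

text \<open>This is how sums over \<open>a x + b y = n\<close> enter: the Cauchy product splits \<open>n\<close> as \<open>i + (n - i)\<close>, and the two
divisor sums factor \<open>i = a x\<close> and \<open>n - i = b y\<close>.\<close>

lemma divisor_series_mult_nth:
  "(divisor_series u * divisor_series v) $ n = quad_sum n (\<lambda>a x b y. True) (\<lambda>a x b y. u a x * v b y)"
proof -
  let ?D = "\<lambda>n. {d. d dvd n \<and> 0 < (n::nat)}"
  have fin: "finite (?D n)" for n by (auto intro: finite_divisors_nat finite_subset[of _ "{d. d dvd n}"])
  have "(divisor_series u * divisor_series v) $ n
      = (\<Sum>i\<in>{0..n}. \<Sum>(d, e)\<in>?D i \<times> ?D (n - i). u d (i div d) * v e ((n - i) div e))"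
    by (simp add: fps_mult_nth divisor_series_def sum_product sum.cartesian_product)
  also have "\<dots> = (\<Sum>(i, d, e)\<in>Sigma {0..n} (\<lambda>i. ?D i \<times> ?D (n - i)). u d (i div d) * v e ((n - i) div e))"
    by (subst sum.Sigma) (auto simp: fin split_def)
  also have "\<dots> = quad_sum n (\<lambda>a x b y. True) (\<lambda>a x b y. u a x * v b y)"
    unfolding quad_sum_def
    by (rule sum.reindex_bij_witness[where j = "\<lambda>(i, d, e). (d, i div d, e, (n - i) div e)"
          and i = "\<lambda>(a, x, b, y). (a * x, a, b)"])
       (auto simp: quads_def dvd_pos_nat div_greater_zero_iff dvd_imp_le, (metis dvd_pos_nat zero_less_diff)+)
  finally show ?thesis .
qed

text \<open>On \<open>a = b\<close> the equation reads \<open>a (x + y) = M\<close>.\<close>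

lemma quad_sum_diagonal_ab:
  assumes "0 < M"
  shows "quad_sum M (\<lambda>a x b y. a = b) f = (\<Sum>d | d dvd M. \<Sum>j\<in>{1..<M div d}. f d j d (M div d - j))"
proof -
  have "(\<Sum>d | d dvd M. \<Sum>j\<in>{1..<M div d}. f d j d (M div d - j))
      = (\<Sum>(d, j)\<in>Sigma {d. d dvd M} (\<lambda>d. {1..<M div d}). f d j d (M div d - j))"
    using assms by (subst sum.Sigma) (auto simp: finite_divisors_nat)
  also have "\<dots> = quad_sum M (\<lambda>a x b y. a = b) f"
    unfolding quad_sum_def
    using assms
    by (intro sum.reindex_bij_witness[where j = "\<lambda>(d, j). (d, j, d, M div d - j)"
          and i = "\<lambda>(a, x, b, y). (a, x)"])
       (auto simp: quads_def distrib_left[symmetric] dvd_pos_nat)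
  finally show ?thesis ..
qed

text \<open>On \<open>x = y\<close> the equation reads \<open>(a + b) x = M\<close>; the divisor is \<open>d = a + b\<close>.\<close>

lemma quad_sum_diagonal_xy:
  assumes "0 < M"
  shows "quad_sum M (\<lambda>a x b y. x = y) f = (\<Sum>d | d dvd M. \<Sum>j\<in>{1..<d}. f j (M div d) (d - j) (M div d))"
proof -
  have "(\<Sum>d | d dvd M. \<Sum>j\<in>{1..<d}. f j (M div d) (d - j) (M div d))
      = (\<Sum>(d, j)\<in>Sigma {d. d dvd M} (\<lambda>d. {1..<d}). f j (M div d) (d - j) (M div d))"
    using assms by (subst sum.Sigma) (auto simp: finite_divisors_nat)
  also have "\<dots> = quad_sum M (\<lambda>a x b y. x = y) f"
    unfolding quad_sum_def
    using assms
    by (intro sum.reindex_bij_witness[where j = "\<lambda>(d, j). (j, M div d, d - j, M div d)"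
          and i = "\<lambda>(a, x, b, y). (a + b, a)"])
       (auto simp: quads_def distrib_right[symmetric] dvd_pos_nat div_greater_zero_iff dvd_imp_le)
  finally show ?thesis ..
qed

lemma quad_sum_restrict:
  assumes "\<And>a x b y. 0 < a \<Longrightarrow> 0 < x \<Longrightarrow> 0 < b \<Longrightarrow> 0 < y \<Longrightarrow> a * x + b * y = M \<Longrightarrow> \<not> P a x b y \<Longrightarrow> f a x b y = 0"
  shows "quad_sum M (\<lambda>a x b y. True) f = quad_sum M P f"
  unfolding quad_sum_def
  by (rule sum.mono_neutral_right) (use assms in \<open>auto simp: quads_def intro: finite_subset[OF _ finite_quads[of M "\<lambda>_ _ _ _. True"]]\<close>)

lemma count_odd_below: "(\<Sum>j\<in>{1..<n}. of_bool (odd j)) = int (n div 2)"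
  and count_even_below: "(\<Sum>j\<in>{1..<n}. of_bool (even j)) = int ((n - 1) div 2)"
proof -
  have "(\<Sum>j\<in>{1..<n}. of_bool (odd j)) = int (n div 2) \<and> (\<Sum>j\<in>{1..<n}. of_bool (even j)) = int ((n - 1) div 2)"
  proof (induction n)
    case (Suc n)
    show ?case
    proof (cases "n = 0")
      case False
      then have "{1..<Suc n} = insert n {1..<n}" by auto
      then have "(\<Sum>j\<in>{1..<Suc n}. of_bool (P j)) = of_bool (P n) + (\<Sum>j\<in>{1..<n}. of_bool (P j) :: int)" for P
        by (simp only:) (subst sum.insert, auto)
      with False Suc show ?thesis by (cases "even n") (auto elim!: evenE oddE simp del: sum_of_bool_eq)
    qed simp
  qed simp
  then show "(\<Sum>j\<in>{1..<n}. of_bool (odd j)) = int (n div 2)" "(\<Sum>j\<in>{1..<n}. of_bool (even j)) = int ((n - 1) div 2)"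
    by blast+
qed

lemma sum_reflect: "(\<Sum>j\<in>{1..<n}. f (n - j)) = (\<Sum>j\<in>{1..<n}. f j)" for n :: nat
  by (rule sum.reindex_bij_witness[where i = "\<lambda>j. n - j" and j = "\<lambda>j. n - j"]) auto

lemma count_odd: "(\<Sum>j\<in>{1..<n}. of_bool (odd (n - j))) = int (n div 2)"
  unfolding sum_reflect[of "\<lambda>j. of_bool (odd j)"] by (rule count_odd_below)

lemma count_even: "(\<Sum>j\<in>{1..<n}. of_bool (even (n - j))) = int ((n - 1) div 2)"
  unfolding sum_reflect[of "\<lambda>j. of_bool (even j)"] by (rule count_even_below)

text \<open>The weight requires \<open>a\<close> odd, \<open>b\<close> even and \<open>x + y\<close> odd, so that \<open>g\<close> is the indicator of \<open>a\<close> and \<open>y\<close>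
odd. It is used with \<open>M\<close> odd for the square of \<open>psi\<close>, and with \<open>M\<close> twice an odd number for the product of the
two weight one series.\<close>

lemma liouville_odd_even:
  fixes F :: "int \<Rightarrow> int"
  assumes "0 < M" and even_F: "\<And>c. F (- c) = F c"
  shows "quad_sum M (\<lambda>a x b y. True) (\<lambda>a x b y. of_bool (odd a \<and> even b \<and> odd (x + y)) * (F (int a - int b) - F (int a + int b)))
    = (\<Sum>d | d dvd M. of_bool (odd d) * F (int d) * int (M div d div 2))
    - (\<Sum>d | d dvd M. of_bool (odd (M div d)) * (\<Sum>j\<in>{1..<d}. of_bool (odd j) * F (int j)))"
proof -
  define w where "w p q r s = (of_bool (p \<and> \<not> r \<and> (q \<noteq> s)) :: int)" for p q r s :: bool
  have g: "w (p \<noteq> r) q r (q \<noteq> s) + w r (q \<noteq> s) (p \<noteq> r) q = of_bool (p \<and> s)" for p q r s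
    by (auto simp: w_def)
  have "quad_sum M (\<lambda>a x b y. True) (\<lambda>a x b y. of_bool (odd a \<and> even b \<and> odd (x + y)) * (F (int a - int b) - F (int a + int b)))
    = quad_sum M (\<lambda>a x b y. True) (\<lambda>a x b y. w (odd a) (odd x) (odd b) (odd y) * (F (int a - int b) - F (int a + int b)))"
    by (simp add: w_def)
  also have "\<dots> = quad_sum M (\<lambda>a x b y. a = b) (\<lambda>a x b y. w (odd a) (odd x) (odd b) (odd y) * F 0 + of_bool (odd a \<and> odd y) * F (int a))
    - quad_sum M (\<lambda>a x b y. x = y) (\<lambda>a x b y. w (odd a) (odd x) (odd b) (odd y) * F (int a + int b) + of_bool (odd a \<and> odd y) * F (int a))"
    by (rule liouville_parity[where F = F and w = w, unfolded g, OF even_F]) auto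
  also have "\<dots> = quad_sum M (\<lambda>a x b y. a = b) (\<lambda>a x b y. of_bool (odd a) * F (int a) * of_bool (odd y))
    - quad_sum M (\<lambda>a x b y. x = y) (\<lambda>a x b y. of_bool (odd y) * (of_bool (odd a) * F (int a)))"
    by (intro arg_cong2[where f = "(-)"] quad_sum_cong) (auto simp: w_def)
  finally show ?thesis
    by (simp only: quad_sum_diagonal_ab[OF assms(1)] quad_sum_diagonal_xy[OF assms(1)] sum_distrib_left[symmetric] count_odd)
qed

text \<open>Used for the square of the divisor series of \<open>chi_m8\<close>.\<close>

lemma liouville_odd_odd:
  fixes F :: "int \<Rightarrow> int"
  assumes "0 < M" and even_F: "\<And>c. F (- c) = F c"
  shows "quad_sum M (\<lambda>a x b y. True) (\<lambda>a x b y. of_bool (odd a \<and> odd b) * (F (int a - int b) - F (int a + int b)))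
    = (\<Sum>d | d dvd M. of_bool (odd d) * F 0 * int (M div d - 1))
    - (\<Sum>d | d dvd M. of_bool (even d) * F (int d) * int (d div 2)
        + 2 * (of_bool (odd d) * (\<Sum>j\<in>{1..<d}. of_bool (even j) * F (int j))))"
proof -
  define w where "w p q r s = (of_bool (p \<and> r) :: int)" for p q r s :: bool
  have g: "w (p \<noteq> r) q r (q \<noteq> s) + w r (q \<noteq> s) (p \<noteq> r) q = 2 * of_bool (r \<and> \<not> p)" for p q r s
    by (auto simp: w_def)
  have "quad_sum M (\<lambda>a x b y. True) (\<lambda>a x b y. of_bool (odd a \<and> odd b) * (F (int a - int b) - F (int a + int b)))
    = quad_sum M (\<lambda>a x b y. True) (\<lambda>a x b y. w (odd a) (odd x) (odd b) (odd y) * (F (int a - int b) - F (int a + int b)))"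
    by (simp add: w_def)
  also have "\<dots> = quad_sum M (\<lambda>a x b y. a = b) (\<lambda>a x b y. w (odd a) (odd x) (odd b) (odd y) * F 0 + 2 * of_bool (odd b \<and> \<not> odd a) * F (int a))
    - quad_sum M (\<lambda>a x b y. x = y) (\<lambda>a x b y. w (odd a) (odd x) (odd b) (odd y) * F (int a + int b) + 2 * of_bool (odd b \<and> \<not> odd a) * F (int a))"
    by (rule liouville_parity[where F = F and w = w, unfolded g, OF even_F]) auto
  also have "\<dots> = quad_sum M (\<lambda>a x b y. a = b) (\<lambda>a x b y. of_bool (odd a) * F 0)
    - quad_sum M (\<lambda>a x b y. x = y) (\<lambda>a x b y. of_bool (even (a + b)) * F (int (a + b)) * of_bool (odd a) + 2 * (of_bool (odd (a + b)) * (of_bool (even a) * F (int a))))"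
    by (intro arg_cong2[where f = "(-)"] quad_sum_cong) (auto simp: w_def)
  also have "quad_sum M (\<lambda>a x b y. a = b) (\<lambda>a x b y. of_bool (odd a) * F 0) = (\<Sum>d | d dvd M. of_bool (odd d) * F 0 * int (M div d - 1))"
    using assms(1) by (simp add: quad_sum_diagonal_ab mult.commute)
  also have "quad_sum M (\<lambda>a x b y. x = y) (\<lambda>a x b y. of_bool (even (a + b)) * F (int (a + b)) * of_bool (odd a) + 2 * (of_bool (odd (a + b)) * (of_bool (even a) * F (int a))))
    = (\<Sum>d | d dvd M. \<Sum>j\<in>{1..<d}. of_bool (even d) * F (int d) * of_bool (odd j) + 2 * (of_bool (odd d) * (of_bool (even j) * F (int j))))"
    unfolding quad_sum_diagonal_xy[OF assms(1)]
  proof (intro sum.cong refl, goal_cases)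
    case (1 d j)
    then have "j + (d - j) = d" by simp
    then show ?case by (simp only:)
  qed
  also have "\<dots> = (\<Sum>d | d dvd M. of_bool (even d) * F (int d) * int (d div 2)
        + 2 * (of_bool (odd d) * (\<Sum>j\<in>{1..<d}. of_bool (even j) * F (int j))))"
    by (simp only: sum.distrib sum_distrib_left[symmetric] count_odd_below)
  finally show ?thesis .
qed

text \<open>Used for the product of the divisor series of \<open>chi_m4\<close> with its dilation, where even \<open>y\<close> encodes the
factor 2.\<close>

lemma liouville_odd_odd_even:
  fixes F :: "int \<Rightarrow> int"
  assumes "0 < M" and even_F: "\<And>c. F (- c) = F c"
  shows "quad_sum M (\<lambda>a x b y. True) (\<lambda>a x b y. of_bool (odd a \<and> odd b \<and> even y) * (F (int a - int b) - F (int a + int b)))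
    = (\<Sum>d | d dvd M. of_bool (odd d) * F 0 * int ((M div d - 1) div 2))
    - (\<Sum>d | d dvd M. of_bool (even d \<and> even (M div d)) * F (int d) * int (d div 2)
        + (1 + of_bool (even (M div d))) * (of_bool (odd d) * (\<Sum>j\<in>{1..<d}. of_bool (even j) * F (int j))))"
proof -
  define w where "w p q r s = (of_bool (p \<and> r \<and> \<not> s) :: int)" for p q r s :: bool
  define g where "g p q r s = (of_bool (r \<and> \<not> p) * (of_bool (q = s) + of_bool (\<not> q)) :: int)" for p q r s :: bool
  have g: "w (p \<noteq> r) q r (q \<noteq> s) + w r (q \<noteq> s) (p \<noteq> r) q = g p q r s" for p q r s
    by (auto simp: w_def g_def)
  have "quad_sum M (\<lambda>a x b y. True) (\<lambda>a x b y. of_bool (odd a \<and> odd b \<and> even y) * (F (int a - int b) - F (int a + int b)))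
    = quad_sum M (\<lambda>a x b y. True) (\<lambda>a x b y. w (odd a) (odd x) (odd b) (odd y) * (F (int a - int b) - F (int a + int b)))"
    by (simp add: w_def)
  also have "\<dots> = quad_sum M (\<lambda>a x b y. a = b) (\<lambda>a x b y. w (odd a) (odd x) (odd b) (odd y) * F 0 + g (odd a) (odd x) (odd b) (odd y) * F (int a))
    - quad_sum M (\<lambda>a x b y. x = y) (\<lambda>a x b y. w (odd a) (odd x) (odd b) (odd y) * F (int a + int b) + g (odd a) (odd x) (odd b) (odd y) * F (int a))"
    by (rule liouville_parity[where F = F and w = w, unfolded g, OF even_F]) (auto simp: g_def)
  also have "\<dots> = quad_sum M (\<lambda>a x b y. a = b) (\<lambda>a x b y. of_bool (odd a) * F 0 * of_bool (even y))
    - quad_sum M (\<lambda>a x b y. x = y) (\<lambda>a x b y. of_bool (even (a + b) \<and> even y) * F (int (a + b)) * of_bool (odd a)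
        + (1 + of_bool (even y)) * (of_bool (odd (a + b)) * (of_bool (even a) * F (int a))))"
    by (intro arg_cong2[where f = "(-)"] quad_sum_cong) (auto simp: w_def g_def)
  also have "quad_sum M (\<lambda>a x b y. a = b) (\<lambda>a x b y. of_bool (odd a) * F 0 * of_bool (even y)) = (\<Sum>d | d dvd M. of_bool (odd d) * F 0 * int ((M div d - 1) div 2))"
    by (simp only: quad_sum_diagonal_ab[OF assms(1)] sum_distrib_left[symmetric] count_even)
  also have "quad_sum M (\<lambda>a x b y. x = y) (\<lambda>a x b y. of_bool (even (a + b) \<and> even y) * F (int (a + b)) * of_bool (odd a)
        + (1 + of_bool (even y)) * (of_bool (odd (a + b)) * (of_bool (even a) * F (int a))))
    = (\<Sum>d | d dvd M. \<Sum>j\<in>{1..<d}. of_bool (even d \<and> even (M div d)) * F (int d) * of_bool (odd j)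
        + (1 + of_bool (even (M div d))) * (of_bool (odd d) * (of_bool (even j) * F (int j))))"
    unfolding quad_sum_diagonal_xy[OF assms(1)]
  proof (intro sum.cong refl, goal_cases)
    case (1 d j)
    then have "j + (d - j) = d" by simp
    then show ?case by (simp only:)
  qed
  also have "\<dots> = (\<Sum>d | d dvd M. of_bool (even d \<and> even (M div d)) * F (int d) * int (d div 2)
        + (1 + of_bool (even (M div d))) * (of_bool (odd d) * (\<Sum>j\<in>{1..<d}. of_bool (even j) * F (int j))))"
    by (simp only: sum.distrib sum_distrib_left[symmetric] count_odd_below)
  finally show ?thesis .
qed

section \<open>Quadratic characters of conductor dividing 8\<close>

text \<open>The three characters are the Kronecker symbols of discriminant -4, 8 and -8.\<close>

definition chi_m4 :: "int \<Rightarrow> int" where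
  "chi_m4 c = (if c mod 4 = 1 then 1 else if c mod 4 = 3 then -1 else 0)"

definition chi_8 :: "int \<Rightarrow> int" where
  "chi_8 c = (if c mod 8 \<in> {1, 7} then 1 else if c mod 8 \<in> {3, 5} then -1 else 0)"

definition chi_m8 :: "int \<Rightarrow> int" where
  "chi_m8 c = (if c mod 8 \<in> {1, 3} then 1 else if c mod 8 \<in> {5, 7} then -1 else 0)"

text \<open>On even \<open>c\<close> this is \<open>cos(\<pi> c / 2)\<close>, and \<open>cos_quarter c\<close> is \<open>cos(\<pi> c / 4)\<close>; both are only evaluated at even
arguments. On odd arguments \<open>chi_m4\<close>, \<open>chi_m8\<close> and \<open>chi_8\<close> are \<open>sin(\<pi> c / 2)\<close>, \<open>\<surd>2 sin(\<pi> c / 4)\<close>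
and \<open>\<surd>2 cos(\<pi> c / 4)\<close>. The addition theorems below are those of sine and cosine; they put products of
characters into the form \<open>F(a - b) - F(a + b)\<close> that Liouville's method needs.\<close>

definition cos_half :: "int \<Rightarrow> int" where
  "cos_half c = (if c mod 4 = 0 then 1 else if c mod 4 = 2 then -1 else 0)"

definition cos_quarter :: "int \<Rightarrow> int" where
  "cos_quarter c = (if c mod 8 = 0 then 1 else if c mod 8 = 4 then -1 else 0)"

lemma chi_m4_minus: "chi_m4 (- c) = - chi_m4 c"
  unfolding chi_m4_def by presburger

lemma chi_8_minus: "chi_8 (- c) = chi_8 c"
  unfolding chi_8_def insert_iff empty_iff by presburger

lemma cos_half_minus: "cos_half (- c) = cos_half c"
  unfolding cos_half_def by presburger

lemma cos_quarter_minus: "cos_quarter (- c) = cos_quarter c"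
  unfolding cos_quarter_def by presburger

lemma chi_m4_shift:
  "chi_m4 (a + 2 * k) = (if even k then chi_m4 a else - chi_m4 a)"
  "chi_m4 (a - 2 * k) = (if even k then chi_m4 a else - chi_m4 a)"
  unfolding chi_m4_def by presburger+

lemma odd_mod_8: "odd (a::int) \<Longrightarrow> a mod 8 = 1 \<or> a mod 8 = 3 \<or> a mod 8 = 5 \<or> a mod 8 = 7"
  by presburger

lemma mod_4_cases: "(a::int) mod 4 = 0 \<or> a mod 4 = 1 \<or> a mod 4 = 2 \<or> a mod 4 = 3"
  by presburger

lemma chi_8_addition:
  assumes "odd a"
  shows "chi_8 (a - 2 * k) - chi_8 (a + 2 * k) = 2 * (chi_m8 a * chi_m4 k)"
proof -
  have 2: "2 * k mod 8 = 2 * (k mod 4)" by presburger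
  have "(a - 2 * k) mod 8 = (a mod 8 - 2 * (k mod 4)) mod 8"
    unfolding 2[symmetric] by (simp only: mod_diff_eq)
  moreover have "(a + 2 * k) mod 8 = (a mod 8 + 2 * (k mod 4)) mod 8"
    unfolding 2[symmetric] by (simp only: mod_add_eq)
  ultimately show ?thesis
    unfolding chi_8_def chi_m8_def chi_m4_def
    using odd_mod_8[OF assms] mod_4_cases[of k] by (elim disjE) simp_all
qed

lemma cos_quarter_addition:
  assumes "odd a" "odd b"
  shows "cos_quarter (a - b) - cos_quarter (a + b) = chi_m8 a * chi_m8 b"
proof -
  have "(a - b) mod 8 = (a mod 8 - b mod 8) mod 8" "(a + b) mod 8 = (a mod 8 + b mod 8) mod 8"
    by (simp_all only: mod_diff_eq mod_add_eq)
  then show ?thesis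
    unfolding cos_quarter_def chi_m8_def
    using odd_mod_8[OF assms(1)] odd_mod_8[OF assms(2)] by (elim disjE) simp_all
qed

lemma cos_half_addition:
  assumes "odd a" "odd b"
  shows "cos_half (a - b) - cos_half (a + b) = 2 * (chi_m4 a * chi_m4 b)"
proof -
  have "(a - b) mod 4 = (a mod 4 - b mod 4) mod 4" "(a + b) mod 4 = (a mod 4 + b mod 4) mod 4"
    by (simp_all only: mod_diff_eq mod_add_eq)
  moreover have "a mod 4 = 1 \<or> a mod 4 = 3" "b mod 4 = 1 \<or> b mod 4 = 3" using assms by presburger+
  ultimately show ?thesis
    unfolding cos_half_def chi_m4_def by (elim disjE) simp_all
qed

lemma chi_even: "even c \<Longrightarrow> chi_m4 c = 0" "even c \<Longrightarrow> chi_8 c = 0" "even c \<Longrightarrow> chi_m8 c = 0"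
  unfolding chi_m4_def chi_8_def chi_m8_def insert_iff empty_iff by presburger+

lemma chi_m4_odd: "chi_m4 (int (2 * m + 1)) = (-1) ^ m"
proof (induction m)
  case (Suc m)
  have "int (2 * Suc m + 1) = int (2 * m + 1) + 2 * 1" by simp
  then show ?case by (simp only: chi_m4_shift Suc) simp
qed (simp add: chi_m4_def)

lemma sum_two_more_terms:
  "(\<Sum>j\<in>{1..<2 * Suc m + 1}. f j :: int) = (\<Sum>j\<in>{1..<2 * m + 1}. f j) + f (2 * m + 1) + f (2 * m + 2)"
proof -
  have "2 * Suc m + 1 = Suc (Suc (2 * m + 1))" by simp
  then show ?thesis by (simp only: sum.atLeastLessThan_Suc) simp
qed

lemma sum_chi_m4:
  assumes "odd d"
  shows "2 * (\<Sum>j\<in>{1..<d}. of_bool (odd j) * (int j * chi_m4 (int j))) = - chi_m4 (int d) * (int d - 1)"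
proof -
  have claim: "2 * (\<Sum>j\<in>{1..<2 * m + 1}. of_bool (odd j) * (int j * chi_m4 (int j))) = - ((-1) ^ m * int (2 * m))" for m
  proof (induction m)
    case (Suc m)
    have "2 * (\<Sum>j\<in>{1..<2 * Suc m + 1}. of_bool (odd j) * (int j * chi_m4 (int j)))
      = - ((-1) ^ m * int (2 * m)) + 2 * int (2 * m + 1) * (-1) ^ m"
      unfolding sum_two_more_terms distrib_left Suc chi_m4_odd by simp
    then show ?case by (simp add: algebra_simps)
  qed simp
  obtain m where m: "d = 2 * m + 1" using assms by (elim oddE)
  show ?thesis unfolding m claim chi_m4_odd by simp
qed

lemma sum_chi_8:
  assumes "odd d"
  shows "(\<Sum>j\<in>{1..<2 * d}. of_bool (odd j) * chi_8 (int j)) = chi_m4 (int d)"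
proof -
  have "(\<Sum>j\<in>{1..<2 * (2 * m + 1)}. of_bool (odd j) * chi_8 (int j)) = (-1) ^ m" for m
  proof (induction m)
    case 0
    have "{1..<2 * (2 * 0 + 1)} = {1::nat}" by auto
    then show ?case by (simp only:) (simp add: chi_8_def)
  next
    case (Suc m)
    have c: "chi_8 (int (4 * m + 3)) = - ((-1) ^ m)" "chi_8 (int (4 * m + 5)) = - ((-1) ^ m)"
    proof -
      have "int (4 * m + 3) mod 8 = (if even m then 3 else 7)" "int (4 * m + 5) mod 8 = (if even m then 5 else 1)"
        by presburger+
      then show "chi_8 (int (4 * m + 3)) = - ((-1) ^ m)" "chi_8 (int (4 * m + 5)) = - ((-1) ^ m)"
        unfolding chi_8_def by (cases "even m"; simp)+
    qed
    have ivl: "{1..<2 * (2 * Suc m + 1)} = insert (4 * m + 3) (insert (4 * m + 5) (insert (4 * m + 2) (insert (4 * m + 4) {1..<2 * (2 * m + 1)})))" by auto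
    have "(\<Sum>j\<in>{1..<2 * (2 * Suc m + 1)}. of_bool (odd j) * chi_8 (int j))
      = - 2 * ((-1) ^ m) + (\<Sum>j\<in>{1..<2 * (2 * m + 1)}. of_bool (odd j) * chi_8 (int j))"
      unfolding ivl by (subst sum.insert, simp, simp, subst sum.insert, simp, simp,
         subst sum.insert, simp, simp, subst sum.insert, simp, simp, simp only: c, simp)
    then show ?case using Suc by simp
  qed
  moreover obtain m where m: "d = 2 * m + 1" using assms by (elim oddE)
  ultimately show ?thesis by (simp only: m chi_m4_odd)
qed

text \<open>A common telescoping argument for the next two sums, which occur on the diagonal \<open>x = y\<close>.\<close>

lemma sum_even_cos:
  fixes c chi :: "int \<Rightarrow> int"
  assumes "odd d" and "chi 1 = 1"
    and step: "\<And>m. 2 * c (2 * int m + 2) = chi (2 * int m + 3) - chi (2 * int m + 1)"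
  shows "2 * (\<Sum>j\<in>{1..<d}. of_bool (even j) * c (int j)) = chi (int d) - 1"
proof -
  have claim: "2 * (\<Sum>j\<in>{1..<2 * m + 1}. of_bool (even j) * c (int j)) = chi (2 * int m + 1) - 1" for m
  proof (induction m)
    case (Suc m)
    have "2 * int (Suc m) + 1 = 2 * int m + 3" by simp
    moreover have "2 * (\<Sum>j\<in>{1..<2 * Suc m + 1}. of_bool (even j) * c (int j))
      = chi (2 * int m + 1) - 1 + 2 * c (2 * int m + 2)"
      unfolding sum_two_more_terms distrib_left Suc by (simp add: add.commute)
    ultimately show ?case using step[of m] by (simp only:)
  qed (simp add: assms(2))
  obtain m where m: "d = 2 * m + 1" using assms(1) by (elim oddE)
  show ?thesis unfolding m claim by (simp add: add.commute)
qed

lemma sum_cos_quarter: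
  "odd d \<Longrightarrow> 2 * (\<Sum>j\<in>{1..<d}. of_bool (even j) * cos_quarter (int j)) = chi_m8 (int d) - 1"
proof (rule sum_even_cos)
  fix m
  have "int m mod 4 = 0 \<or> int m mod 4 = 1 \<or> int m mod 4 = 2 \<or> int m mod 4 = 3" by presburger
  moreover have "2 * (int m mod 4) = 2 * int m mod 8" by presburger
  then have "(2 * int m + c) mod 8 = (2 * (int m mod 4) + c) mod 8" for c by (simp only: mod_add_left_eq)
  ultimately show "2 * cos_quarter (2 * int m + 2) = chi_m8 (2 * int m + 3) - chi_m8 (2 * int m + 1)"
    unfolding cos_quarter_def chi_m8_def by (elim disjE) simp_all
qed (simp_all add: chi_m8_def)

lemma sum_cos_half:
  "odd d \<Longrightarrow> 2 * (\<Sum>j\<in>{1..<d}. of_bool (even j) * cos_half (int j)) = chi_m4 (int d) - 1"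
proof (rule sum_even_cos)
  fix m
  have "int m mod 2 = 0 \<or> int m mod 2 = 1" by presburger
  moreover have "2 * (int m mod 2) = 2 * int m mod 4" by presburger
  then have "(2 * int m + c) mod 4 = (2 * (int m mod 2) + c) mod 4" for c by (simp only: mod_add_left_eq)
  ultimately show "2 * cos_half (2 * int m + 2) = chi_m4 (2 * int m + 3) - chi_m4 (2 * int m + 1)"
    unfolding cos_half_def chi_m4_def by (elim disjE) simp_all
qed (simp_all add: chi_m4_def)

section \<open>Divisor series\<close>

text \<open>A factorization of \<open>n / m\<close> is a factorization of \<open>n\<close> whose second factor is a multiple of \<open>m\<close>.\<close>

lemma divisor_series_dilate_right:
  assumes "0 < m"
  shows "divisor_series u oo fps_X ^ m = divisor_series (\<lambda>d e. if m dvd e then u d (e div m) else 0)"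
proof (rule fps_ext)
  fix n
  show "(divisor_series u oo fps_X ^ m) $ n = divisor_series (\<lambda>d e. if m dvd e then u d (e div m) else 0) $ n"
  proof (cases "0 < n")
    case True
    have set: "{d. d dvd n \<and> m dvd n div d} = (if m dvd n then {d. d dvd n div m} else {})"
    proof (intro set_eqI iffI)
      fix d assume "d \<in> {d. d dvd n \<and> m dvd n div d}"
      then obtain f where "n div d = m * f" "d dvd n" by (auto elim: dvdE)
      then have "n = m * (d * f)" by (metis dvd_mult_div_cancel mult.left_commute)
      then show "d \<in> (if m dvd n then {d. d dvd n div m} else {})" using assms by simp
    next
      fix d assume d: "d \<in> (if m dvd n then {d. d dvd n div m} else {})"
      then have "m dvd n" "d dvd n div m" by (auto split: if_splits)
      then obtain f where "n div m = d * f" by (auto elim: dvdE)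
      then have "n = d * (m * f)" using \<open>m dvd n\<close> by (metis dvd_mult_div_cancel mult.left_commute)
      moreover from this have "0 < d" using True by (cases d) auto
      ultimately show "d \<in> {d. d dvd n \<and> m dvd n div d}" by simp
    qed
    have "divisor_series (\<lambda>d e. if m dvd e then u d (e div m) else 0) $ n
       = (\<Sum>d | d dvd n \<and> m dvd n div d. u d (n div d div m))"
      unfolding divisor_series_def fps_nth_Abs_fps
      using True by (intro sum.mono_neutral_cong_right) (auto simp: finite_divisors_nat)
    also have "\<dots> = (if m dvd n then \<Sum>d | d dvd n div m. u d (n div m div d) else 0)"
      unfolding set by (auto simp: div_mult2_eq[symmetric] mult.commute)
    also have "\<dots> = (divisor_series u oo fps_X ^ m) $ n"
      using True assms by (auto simp: divisor_series_def compose_X_power_nth div_greater_zero_iff dvd_imp_le)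
    finally show ?thesis ..
  qed (simp add: divisor_series_def compose_X_power_nth assms)
qed

lemma divisor_series_swap: "divisor_series u = divisor_series (\<lambda>d e. u e d)"
proof (rule fps_ext)
  fix n show "divisor_series u $ n = divisor_series (\<lambda>d e. u e d) $ n"
    unfolding divisor_series_def fps_nth_Abs_fps
    by (rule sum.reindex_bij_witness[where i = "\<lambda>d. n div d" and j = "\<lambda>d. n div d"])
       (auto elim!: dvdE)
qed

lemma divisor_series_dilate_left:
  assumes "0 < m"
  shows "divisor_series u oo fps_X ^ m = divisor_series (\<lambda>d e. if m dvd d then u (d div m) e else 0)"
  using divisor_series_dilate_right[OF assms, of "\<lambda>d e. u e d"]
  by (simp add: divisor_series_swap[of u] divisor_series_swap[of "\<lambda>d e. if m dvd d then u (d div m) e else 0"])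

section \<open>Triangular numbers in pairs: the square of psi\<close>

text \<open>The logarithmic derivative of \<open>psi\<close>, by \<open>qderiv_psi\<close>.\<close>

definition psi_log :: "int fps" where
  "psi_log = divisor_series (\<lambda>d e. if odd d then int d else - int d)"

text \<open>The odd exponents of the divisor series of \<open>chi_m4\<close>: if \<open>d e\<close> is even and \<open>e\<close> odd, then
\<open>chi_m4 d = 0\<close>.\<close>

definition series_m4_odd :: "int fps" where
  "series_m4_odd = divisor_series (\<lambda>d e. if odd e then chi_m4 (int d) else 0)"

lemma divisor_series_nth_0 [simp]: "divisor_series u $ 0 = 0"
  by (simp add: divisor_series_def)

lemma divisor_series_nth: "0 < n \<Longrightarrow> divisor_series u $ n = (\<Sum>d | d dvd n. u d (n div d))"
  by (simp add: divisor_series_def)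

lemma series_m4_odd_even: "even n \<Longrightarrow> series_m4_odd $ n = 0"
proof (cases "n = 0")
  case False
  assume n: "even n"
  have "(if odd (n div d) then chi_m4 (int d) else 0) = 0" if "d dvd n" for d
  proof (cases "even d")
    case False
    have "even (d * (n div d))" using that n by simp
    then show ?thesis using False by simp
  qed (simp add: chi_even)
  then show ?thesis using False by (simp add: series_m4_odd_def divisor_series_nth)
qed (simp add: series_m4_odd_def)

lemma series_m4_odd_nth:
  assumes "odd n"
  shows "series_m4_odd $ n = (\<Sum>d | d dvd n. chi_m4 (int d))"
proof -
  have "odd (n div d)" if "d dvd n" for d using that assms by (metis dvd_div_mult_self even_mult_iff)
  then show ?thesis using assms by (auto simp: series_m4_odd_def divisor_series_nth odd_pos intro!: sum.cong)
qed

lemma compose_X_power_compose: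
  assumes "0 < m" "0 < k"
  shows "(f oo fps_X ^ m) oo fps_X ^ k = (f :: int fps) oo fps_X ^ (m * k)"
proof (rule fps_ext)
  fix n
  show "((f oo fps_X ^ m) oo fps_X ^ k) $ n = (f oo fps_X ^ (m * k)) $ n"
  proof (cases "k dvd n")
    case True
    then show ?thesis using assms
      by (simp add: compose_X_power_nth dvd_div_iff_mult div_mult2_eq[symmetric] mult.commute)
  next
    case False
    then have "\<not> m * k dvd n" by (meson dvd_mult_right)
    with False show ?thesis using assms by (simp add: compose_X_power_nth)
  qed
qed

text \<open>The exponent 4 is distributed as a factor 2 on each side of \<open>b y\<close>, which makes \<open>b\<close> and \<open>y\<close> both
even, as required by \<open>liouville_odd_even\<close>.\<close>

lemma psi_log_compose:
  "psi_log oo fps_X ^ 4 = divisor_series (\<lambda>b y. if even b \<and> even y then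
      if odd (b div 2) then int (b div 2) else - int (b div 2) else 0)"
proof -
  have "psi_log oo fps_X ^ 4 = (psi_log oo fps_X ^ 2) oo fps_X ^ 2"
    by (simp add: compose_X_power_compose)
  also have "\<dots> = divisor_series (\<lambda>b y. if even b \<and> even y then
      if odd (b div 2) then int (b div 2) else - int (b div 2) else 0)"
    unfolding psi_log_def
    by (subst divisor_series_dilate_right, simp, subst divisor_series_dilate_left, simp)
       (rule arg_cong[where f = divisor_series], auto simp: fun_eq_iff)
  finally show ?thesis .
qed

lemma numeral_mult_nth: "(numeral k * f) $ n = numeral k * (f :: int fps) $ n"
  by (simp add: numeral_fps_const)

text \<open>The differential equation satisfied by \<open>x psi(x^4)^2\<close>, for the divisor series. At odd \<open>n\<close> it states that
four times the convolution is \<open>(n - 1) / 2\<close> times the divisor sum. With \<open>F c = c chi_m4 c\<close> and \<open>b = 2 c\<close>, the difference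
\<open>F(a - b) - F(a + b)\<close> is \<open>4 chi_m4(a)\<close> times \<open>c\<close> or \<open>-c\<close>, according to the parity of \<open>c\<close>; this is four times the
summand of the convolution, and the diagonals combine to \<open>(n - 1) / 2\<close> times the divisor sum.\<close>

lemma series_m4_odd_qderiv: "qderiv series_m4_odd = series_m4_odd + 8 * (series_m4_odd * (psi_log oo fps_X ^ 4))"
proof (rule fps_ext)
  fix n
  define k where "k b = (if odd (b div 2) then int (b div 2) else - int (b div 2))" for b :: nat
  define F where "F c = c * chi_m4 c" for c :: int
  have conv: "(series_m4_odd * (psi_log oo fps_X ^ 4)) $ n
      = quad_sum n (\<lambda>a x b y. True) (\<lambda>a x b y. (if odd x then chi_m4 (int a) else 0) * (if even b \<and> even y then k b else 0))"
    unfolding series_m4_odd_def psi_log_compose divisor_series_mult_nth k_def ..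
  show "qderiv series_m4_odd $ n = (series_m4_odd + 8 * (series_m4_odd * (psi_log oo fps_X ^ 4))) $ n"
  proof (cases "odd n")
    case False
    have "(series_m4_odd * (psi_log oo fps_X ^ 4)) $ n = quad_sum n (\<lambda>a x b y. True) (\<lambda>a x b y. 0)"
      unfolding conv using False by (intro quad_sum_cong) (auto simp: chi_even)
    also have "\<dots> = 0" by (simp add: quad_sum_def split_def)
    finally have "(8 * (series_m4_odd * (psi_log oo fps_X ^ 4))) $ n = 0"
      by (simp add: numeral_fps_const)
    then show ?thesis using False by (simp add: qderiv_nth series_m4_odd_even)
  next
    case True
    then have n: "0 < n" by (rule odd_pos)
    have F: "F (- c) = F c" for c by (simp add: F_def chi_m4_minus)
    have "4 * (series_m4_odd * (psi_log oo fps_X ^ 4)) $ n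
      = quad_sum n (\<lambda>a x b y. True) (\<lambda>a x b y. of_bool (odd a \<and> even b \<and> odd (x + y)) * (F (int a - int b) - F (int a + int b)))"
      unfolding conv quad_sum_cmult[symmetric]
    proof (rule quad_sum_cong, simp, goal_cases)
      case (1 a x b y)
      show ?case
      proof (cases "odd a \<and> even b")
        case odd: True
        have "odd (a * x + b * y)" using 1(5) \<open>odd n\<close> by (simp only: not_False_eq_True)
        with odd have x: "odd x" by simp
        obtain c where b: "b = 2 * c" using odd by (elim conjE evenE)
        have "F (int a - int b) - F (int a + int b) = 4 * (chi_m4 (int a) * k b)"
          unfolding F_def k_def b of_nat_mult of_nat_numeral chi_m4_shift
          by (cases "even c") (simp_all add: algebra_simps)
        with odd x show ?thesis by simp
      next
        case False
        then show ?thesis by (elim disjE[OF de_Morgan_conj[THEN iffD1]]) (simp_all add: chi_even)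
      qed
    qed
    also have "\<dots> = (\<Sum>d | d dvd n. of_bool (odd d) * F (int d) * int (n div d div 2))
        - (\<Sum>d | d dvd n. of_bool (odd (n div d)) * (\<Sum>j\<in>{1..<d}. of_bool (odd j) * F (int j)))"
      by (rule liouville_odd_even[where F = F, OF n F])
    finally have "2 * (4 * (series_m4_odd * (psi_log oo fps_X ^ 4)) $ n)
        = 2 * ((\<Sum>d | d dvd n. of_bool (odd d) * F (int d) * int (n div d div 2))
        - (\<Sum>d | d dvd n. of_bool (odd (n div d)) * (\<Sum>j\<in>{1..<d}. of_bool (odd j) * F (int j))))"
      by (simp only:)
    also have "\<dots> = (\<Sum>d | d dvd n. 2 * (of_bool (odd d) * F (int d) * int (n div d div 2))
           - 2 * (of_bool (odd (n div d)) * (\<Sum>j\<in>{1..<d}. of_bool (odd j) * F (int j))))"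
      by (simp only: sum_subtractf sum_distrib_left right_diff_distrib)
    also have "\<dots> = (\<Sum>d | d dvd n. (int n - 1) * chi_m4 (int d))"
    proof (intro sum.cong refl)
      fix d assume "d \<in> {d. d dvd n}"
      then obtain e where e: "n = d * e" by auto
      with True have d: "odd d" "odd e" "0 < d" by (auto intro: odd_pos)
      then have ne: "n div d = e" by (simp add: e)
      obtain m where "e = 2 * m + 1" using \<open>odd e\<close> by (elim oddE)
      then have m: "2 * int (e div 2) = int e - 1" by simp
      have "2 * (of_bool (odd d) * F (int d) * int (n div d div 2))
           - 2 * (of_bool (odd (n div d)) * (\<Sum>j\<in>{1..<d}. of_bool (odd j) * F (int j)))
         = F (int d) * (2 * int (e div 2)) - 2 * (\<Sum>j\<in>{1..<d}. of_bool (odd j) * F (int j))"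
        unfolding ne using d by simp
      also have "\<dots> = (int n - 1) * chi_m4 (int d)"
        unfolding m F_def sum_chi_m4[OF d(1)] e by (simp add: algebra_simps)
      finally show "2 * (of_bool (odd d) * F (int d) * int (n div d div 2))
           - 2 * (of_bool (odd (n div d)) * (\<Sum>j\<in>{1..<d}. of_bool (odd j) * F (int j)))
         = (int n - 1) * chi_m4 (int d)" .
    qed
    also have "\<dots> = (int n - 1) * series_m4_odd $ n"
      by (simp add: series_m4_odd_nth[OF True] sum_distrib_left)
    finally show ?thesis
      unfolding qderiv_nth fps_add_nth numeral_mult_nth by (simp add: algebra_simps)
  qed
qed

text \<open>At exponent \<open>n\<close> the equation determines \<open>n - 1\<close> times the coefficient by the earlier coefficients, so the
initial values at 0 and 1 fix the solution.\<close>

lemma qderiv_ode_unique: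
  assumes f: "qderiv f = f + f * K" and g: "qderiv g = g + g * K"
    and "K $ 0 = 0" "f $ 0 = g $ 0" "f $ 1 = g $ 1"
  shows "f = g"
proof (rule fps_ext)
  fix n
  define h where "h = f - g"
  have "qderiv h = h + h * K"
    using f g by (simp add: h_def qderiv_def algebra_simps)
  then have h: "int n * h $ n = h $ n + (\<Sum>i=0..n. h $ i * K $ (n - i))" for n
    by (metis qderiv_nth fps_add_nth fps_mult_nth)
  have "h $ n = 0"
  proof (induction n rule: less_induct)
    case (less n)
    have "h $ i * K $ (n - i) = 0" if "i \<in> {0..n}" for i
      using that less assms(3) by (cases "i = n") auto
    then have "int n * h $ n = h $ n" using h[of n] by (simp add: sum.neutral)
    then show ?case using assms(4,5) by (cases "n = 1") (auto simp: h_def)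
  qed
  then show "f $ n = g $ n" by (simp add: h_def)
qed

lemma psi_squared_divisor_series: "fps_X * ((psi * psi) oo fps_X ^ 4) = series_m4_odd"
proof (rule qderiv_ode_unique)
  let ?P = "(psi * psi) oo fps_X ^ 4" and ?K = "psi_log oo fps_X ^ 4"
  have "qderiv (psi * psi) = 2 * (psi * psi * psi_log)"
    unfolding qderiv_mult qderiv_psi psi_log_def[symmetric] by (simp add: algebra_simps)
  then have "qderiv ?P = 4 * ((2 * (psi * psi * psi_log)) oo fps_X ^ 4)"
    by (simp add: qderiv_compose_X_power)
  also have "\<dots> = 8 * (?P * ?K)"
    by (simp add: compose_X_power_mult numeral_fps_const)
  finally have "qderiv ?P = 8 * (?P * ?K)" .
  moreover have "qderiv fps_X = fps_X" by (simp add: qderiv_def)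
  ultimately show "qderiv (fps_X * ?P) = fps_X * ?P + fps_X * ?P * (8 * ?K)"
    by (simp add: qderiv_mult algebra_simps)
  show "qderiv series_m4_odd = series_m4_odd + series_m4_odd * (8 * ?K)"
    using series_m4_odd_qderiv by (simp add: algebra_simps)
  show "(8 * ?K) $ 0 = 0" by (simp add: numeral_fps_const psi_log_def)
  show "(fps_X * ?P) $ 0 = series_m4_odd $ 0" by (simp add: series_m4_odd_even)
  have "psi $ 0 = 1" by (auto simp: psi_nth intro!: exI[of _ 0])
  then show "(fps_X * ?P) $ 1 = series_m4_odd $ 1"
    by (simp add: compose_X_power_nth series_m4_odd_nth chi_m4_def)
qed

section \<open>Sums of two squares, and a square plus twice a square\<close>

definition series_m4 :: "int fps" where "series_m4 = divisor_series (\<lambda>d e. chi_m4 (int d))"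
definition series_m8 :: "int fps" where "series_m8 = divisor_series (\<lambda>d e. chi_m8 (int d))"

text \<open>Even squares are \<open>4 j^2\<close>, and odd squares are \<open>8 t + 1\<close> with \<open>t\<close> triangular.\<close>

lemma phi_dissection: "phi = (phi oo fps_X ^ 4) + 2 * (fps_X * (psi oo fps_X ^ 8))"
proof (rule fps_ext)
  fix n
  have sq_even: "(2 * j)\<^sup>2 = 4 * j\<^sup>2" for j :: nat by (simp add: power2_eq_square)
  have sq_odd: "(2 * k + 1)\<^sup>2 = 8 * (k * (k + 1) div 2) + 1" for k :: nat
  proof -
    have "2 * (k * (k + 1) div 2) = k * (k + 1)" by (rule dvd_mult_div_cancel) simp
    then have "8 * (k * (k + 1) div 2) = 4 * (k * (k + 1))" by linarith
    then show ?thesis by (simp add: power2_eq_square algebra_simps)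
  qed
  have R: "((phi oo fps_X ^ 4) + 2 * (fps_X * (psi oo fps_X ^ 8))) $ n
     = (if 4 dvd n then phi $ (n div 4) else 0) + 2 * (if 0 < n \<and> 8 dvd (n - 1) then psi $ ((n - 1) div 8) else 0)"
    by (simp add: compose_X_power_nth numeral_mult_nth)
  consider "n = 0" | "0 < n" "4 dvd n" | "0 < n" "\<not> 4 dvd n" "8 dvd n - 1" | "0 < n" "\<not> 4 dvd n" "\<not> 8 dvd n - 1" by blast
  then show "phi $ n = ((phi oo fps_X ^ 4) + 2 * (fps_X * (psi oo fps_X ^ 8))) $ n"
  proof cases
    case 1
    then show ?thesis unfolding R by (simp add: phi_nth)
  next
    case 2
    then obtain m where m: "n = 4 * m" "0 < m" by auto
    have "(\<exists>i. n = i\<^sup>2) \<longleftrightarrow> (\<exists>i. m = i\<^sup>2)"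
    proof
      assume "\<exists>i. n = i\<^sup>2"
      then obtain i where i: "n = i\<^sup>2" by blast
      then have "even i" using m by (metis dvd_trans dvd_triv_left even_numeral even_power)
      then obtain j where "i = 2 * j" by (elim evenE)
      then have "4 * m = 4 * j\<^sup>2" using i m sq_even by simp
      then show "\<exists>i. m = i\<^sup>2" by auto
    qed (use m sq_even in metis)
    moreover have "\<not> 8 dvd n - 1" using m by presburger
    ultimately show ?thesis unfolding R using m by (simp add: phi_nth)
  next
    case 3
    then obtain m where m: "n = 8 * m + 1" by (metis Suc_eq_plus1 Suc_pred' dvd_def)
    have "(\<exists>i. n = i\<^sup>2) \<longleftrightarrow> (\<exists>k. m = k * (k + 1) div 2)"
    proof
      assume "\<exists>i. n = i\<^sup>2"
      then obtain i where i: "n = i\<^sup>2" by blast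
      then have "odd (i\<^sup>2)" using m by presburger
      then have "odd i" by simp
      then obtain j where "i = 2 * j + 1" by (elim oddE)
      then have "n = 8 * (j * (j + 1) div 2) + 1" using i sq_odd by simp
      then have "m = j * (j + 1) div 2" using m by linarith
      then show "\<exists>k. m = k * (k + 1) div 2" by blast
    next
      assume "\<exists>k. m = k * (k + 1) div 2"
      then show "\<exists>i. n = i\<^sup>2" using m sq_odd by metis
    qed
    then show ?thesis unfolding R using 3 m by (simp add: phi_nth psi_nth)
  next
    case 4
    have "n \<noteq> i\<^sup>2" for i
    proof
      assume i: "n = i\<^sup>2"
      show False
      proof (cases "even i")
        case True
        then obtain j where "i = 2 * j" by (elim evenE)
        then show False using 4 i sq_even by simp
      next
        case False
        then obtain j where "i = 2 * j + 1" by (elim oddE)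
        then have "n = 8 * (j * (j + 1) div 2) + 1" using i sq_odd by simp
        then show False using 4 by simp
      qed
    qed
    then show ?thesis unfolding R using 4 by (simp add: phi_nth)
  qed
qed

text \<open>A nonzero coefficient at \<open>n > 0\<close> would force one at \<open>n / 2\<close>, and so on by descent.\<close>

lemma dilation_fixed_zero:
  fixes f :: "int fps"
  assumes "f = c * (f oo fps_X ^ 2)" "c = 1 \<or> c = -1" "f $ 0 = 0"
  shows "f = 0"
proof (rule fps_ext)
  fix n
  have "f $ n = 0"
  proof (induction n rule: less_induct)
    case (less n)
    have "f $ n = (f oo fps_X ^ 2) $ n \<or> f $ n = - (f oo fps_X ^ 2) $ n"
      using assms(1,2) by (metis fps_neg_nth mult_1 mult_minus1)
    moreover have "(f oo fps_X ^ 2) $ n = 0"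
      using less assms(3) by (cases "n = 0") (auto simp: compose_X_power_nth)
    ultimately show ?case by auto
  qed
  then show "f $ n = 0 $ n" by simp
qed

lemma compose_X_power_X: "fps_X oo fps_X ^ m = (fps_X ^ m :: int fps)" if "0 < m"
  using that by (intro fps_X_fps_compose_startby0) simp

lemma compose_numeral: "numeral k oo f = (numeral k :: int fps)"
  by (simp add: numeral_fps_const)

text \<open>The difference \<open>D\<close> of the two sides satisfies \<open>D(x) = - D(x^2)\<close>: squaring \<open>phi_dissection\<close> writes
\<open>phi(x)^2\<close> as \<open>phi(x^4)^2 + 4 x^2 psi(x^8)^2 + 4 x phi(x^4) psi(x^8)\<close>, and the last product is
\<open>psi(x^4)^2\<close> by \<open>psi_squared_factorization\<close>.\<close>

lemma phi_squared_dissection: "phi * phi = ((phi * phi) oo fps_X ^ 2) + 4 * series_m4_odd"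
proof -
  define B where "B = 4 * (fps_X * ((psi * psi) oo fps_X ^ 4))"
  have ab: "(phi oo fps_X ^ 4) * (psi oo fps_X ^ 8) = (psi * psi) oo fps_X ^ 4"
    unfolding psi_squared_factorization compose_X_power_mult[OF zero_less_numeral] by (simp add: compose_X_power_compose)
  have B2: "B oo fps_X ^ 2 = 4 * (fps_X ^ 2 * ((psi * psi) oo fps_X ^ 8))"
    unfolding B_def compose_X_power_mult[OF zero_less_numeral] compose_numeral compose_X_power_X[OF zero_less_numeral]
    by (simp add: compose_X_power_compose)
  have pp: "((phi * phi) oo fps_X ^ 2) oo fps_X ^ 2 = (phi oo fps_X ^ 4) * (phi oo fps_X ^ 4)"
    by (simp add: compose_X_power_compose compose_X_power_mult)
  have "phi * phi = ((phi oo fps_X ^ 4) + 2 * (fps_X * (psi oo fps_X ^ 8))) * ((phi oo fps_X ^ 4) + 2 * (fps_X * (psi oo fps_X ^ 8)))"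
    using phi_dissection by simp
  also have "\<dots> = (phi oo fps_X ^ 4) * (phi oo fps_X ^ 4) + 4 * (fps_X ^ 2 * ((psi oo fps_X ^ 8) * (psi oo fps_X ^ 8)))
      + 4 * (fps_X * ((phi oo fps_X ^ 4) * (psi oo fps_X ^ 8)))"
    by (simp add: algebra_simps power2_eq_square)
  also have "\<dots> = (((phi * phi) oo fps_X ^ 2) oo fps_X ^ 2) + (B oo fps_X ^ 2) + B"
    unfolding ab B2 pp by (simp add: B_def compose_X_power_mult)
  finally have I: "phi * phi = (((phi * phi) oo fps_X ^ 2) oo fps_X ^ 2) + (B oo fps_X ^ 2) + B" .
  define D where "D = phi * phi - ((phi * phi) oo fps_X ^ 2) - B"
  have Dc: "D oo fps_X ^ 2 = ((phi * phi) oo fps_X ^ 2) - (((phi * phi) oo fps_X ^ 2) oo fps_X ^ 2) - (B oo fps_X ^ 2)"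
    by (simp add: D_def fps_compose_sub_distrib)
  have "p = s + t + b \<Longrightarrow> p - q - b = - 1 * (q - s - t)" for p q s t b :: "int fps" by simp
  from this[OF I] have "D = - 1 * (D oo fps_X ^ 2)" unfolding Dc unfolding D_def .
  moreover have "D $ 0 = 0" by (simp add: D_def B_def)
  ultimately have "D = 0" by (intro dilation_fixed_zero[of D "- 1"]) auto
  then show ?thesis by (simp add: D_def B_def psi_squared_divisor_series diff_eq_eq add.commute)
qed

lemma series_m4_dilate: "series_m4 oo fps_X ^ 2 = divisor_series (\<lambda>d e. if even e then chi_m4 (int d) else 0)"
  unfolding series_m4_def by (subst divisor_series_dilate_right) simp_all

lemma divisor_series_add: "divisor_series u + divisor_series v = divisor_series (\<lambda>d e. u d e + v d e)"
  by (rule fps_ext) (simp add: divisor_series_def sum.distrib)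

lemma series_m4_dissection: "series_m4 = (series_m4 oo fps_X ^ 2) + series_m4_odd"
  unfolding series_m4_dilate series_m4_odd_def divisor_series_add
  unfolding series_m4_def by (rule arg_cong[where f = divisor_series]) (auto simp: fun_eq_iff)

text \<open>Jacobi's two-square theorem. Both sides satisfy the same recursion under \<open>x \<mapsto> x^2\<close> with the same odd part,
so their difference is fixed by this dilation and vanishes.\<close>

lemma phi_squared_divisor_series: "phi * phi = 1 + 4 * series_m4"
proof -
  define D where "D = phi * phi - (1 + 4 * series_m4)"
  have "phi * phi - (1 + 4 * series_m4) = ((phi * phi) oo fps_X ^ 2) - (1 + 4 * (series_m4 oo fps_X ^ 2))"
    by (subst phi_squared_dissection, subst series_m4_dissection) (simp add: algebra_simps)
  also have "\<dots> = 1 * (D oo fps_X ^ 2)"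
    by (simp add: D_def fps_compose_sub_distrib fps_compose_add_distrib compose_X_power_mult compose_numeral)
  finally have "D = 1 * (D oo fps_X ^ 2)" by (simp only: D_def)
  moreover have "D $ 0 = 0" by (simp add: D_def phi_nth series_m4_def)
  ultimately have "D = 0" by (intro dilation_fixed_zero[of D 1]) auto
  then show ?thesis by (simp add: D_def)
qed

lemma cos_quarter_double: "even d \<Longrightarrow> cos_quarter (2 * d) = cos_half d"
proof (elim evenE)
  fix c assume d: "d = 2 * c"
  have "2 * d mod 8 = 2 * (d mod 4)" by presburger
  then show ?thesis unfolding cos_quarter_def cos_half_def d by (simp only:) simp
qed

text \<open>Doubling \<open>d\<close> maps the even divisors with even cofactor onto the divisors that are multiples of 4; at
\<open>d \<equiv> 2 (mod 4)\<close> the function \<open>cos_quarter\<close> vanishes.\<close>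

lemma sum_even_divisors_cos:
  assumes "0 < n"
  shows "(\<Sum>d | d dvd n. of_bool (even d) * cos_quarter (int d) * int d)
    = 2 * (\<Sum>d | d dvd n. of_bool (even d \<and> even (n div d)) * cos_half (int d) * int d)"
proof -
  have "2 * (\<Sum>d | d dvd n. of_bool (even d \<and> even (n div d)) * cos_half (int d) * int d)
    = (\<Sum>d | d dvd n \<and> even d \<and> even (n div d). cos_half (int d) * int (2 * d))"
    unfolding sum_distrib_left
    using assms by (intro sum.mono_neutral_cong_right) (auto simp: finite_divisors_nat)
  also have "\<dots> = (\<Sum>d | d dvd n \<and> 4 dvd d. cos_quarter (int d) * int d)"
  proof (rule sum.reindex_bij_witness[where i = "\<lambda>d. d div 2" and j = "\<lambda>d. 2 * d"], goal_cases)
    case (2 d)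
    then obtain e where "n div d = 2 * e" "d dvd n" by (auto elim: evenE)
    then have "n = 2 * d * e" by (metis dvd_mult_div_cancel mult.assoc mult.commute)
    then show ?case using 2 by simp
  next
    case (4 d)
    then obtain c e where c: "d = 4 * c" "n = d * e" by (auto elim!: dvdE)
    then have "d div 2 = 2 * c" "n div (d div 2) = 2 * e" "n = (d div 2) * (2 * e)" using assms by auto
    then show ?case using dvd_triv_left[of "d div 2" "2 * e"] by simp
  next
    case (5 d)
    then show ?case using cos_quarter_double[of "int d"] by simp
  qed auto
  also have "\<dots> = (\<Sum>d | d dvd n. of_bool (even d) * cos_quarter (int d) * int d)"
  proof (rule sum.mono_neutral_cong_left)
    show "\<forall>d\<in>{d. d dvd n} - {d. d dvd n \<and> 4 dvd d}. of_bool (even d) * cos_quarter (int d) * int d = 0"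
    proof
      fix d assume "d \<in> {d. d dvd n} - {d. d dvd n \<and> 4 dvd d}"
      then have "\<not> 4 dvd d" by simp
      then have "int d mod 8 \<noteq> 0" "int d mod 8 \<noteq> 4" by presburger+
      then show "of_bool (even d) * cos_quarter (int d) * int d = 0" by (simp add: cos_quarter_def)
    qed
  qed (use assms in \<open>auto simp: finite_divisors_nat\<close>)
  finally show ?thesis ..
qed

text \<open>Both sides are evaluated by Liouville's method; at \<open>n > 0\<close> each coefficient is
four times the sum of \<open>n / d\<close> over the odd divisors of \<open>n\<close>, minus a sum over even divisors, and
\<open>sum_even_divisors_cos\<close> identifies the latter.\<close>

lemma series_m8_squared: "(1 + 2 * series_m8) * (1 + 2 * series_m8) = (1 + 4 * series_m4) * ((1 + 4 * series_m4) oo fps_X ^ 2)"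
proof (rule fps_ext)
  fix n
  let ?b2 = "series_m4 oo fps_X ^ 2"
  have L: "(1 + 2 * series_m8) * (1 + 2 * series_m8) = 1 + 4 * series_m8 + 4 * (series_m8 * series_m8)"
    by (simp add: algebra_simps)
  have R: "(1 + 4 * series_m4) * ((1 + 4 * series_m4) oo fps_X ^ 2) = 1 + 4 * series_m4 + 4 * ?b2 + 16 * (series_m4 * ?b2)"
    by (simp add: algebra_simps fps_compose_add_distrib compose_X_power_mult compose_numeral)
  show "((1 + 2 * series_m8) * (1 + 2 * series_m8)) $ n = ((1 + 4 * series_m4) * ((1 + 4 * series_m4) oo fps_X ^ 2)) $ n"
  proof (cases "n = 0")
    case True
    then show ?thesis by (simp add: series_m8_def series_m4_def)
  next
    case False
    then have n: "0 < n" by simp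
    have "(series_m8 * series_m8) $ n = quad_sum n (\<lambda>a x b y. True)
        (\<lambda>a x b y. of_bool (odd a \<and> odd b) * (cos_quarter (int a - int b) - cos_quarter (int a + int b)))"
      unfolding series_m8_def divisor_series_mult_nth
      by (rule quad_sum_cong) (auto simp: cos_quarter_addition chi_even)
    also have "\<dots> = (\<Sum>d | d dvd n. of_bool (odd d) * cos_quarter 0 * int (n div d - 1))
      - (\<Sum>d | d dvd n. of_bool (even d) * cos_quarter (int d) * int (d div 2)
        + 2 * (of_bool (odd d) * (\<Sum>j\<in>{1..<d}. of_bool (even j) * cos_quarter (int j))))"
      by (rule liouville_odd_odd[where F = cos_quarter, OF n cos_quarter_minus])
    finally have "4 * series_m8 $ n + 4 * (series_m8 * series_m8) $ n = (\<Sum>d | d dvd n.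
       4 * chi_m8 (int d) + 4 * (of_bool (odd d) * cos_quarter 0 * int (n div d - 1)
       - (of_bool (even d) * cos_quarter (int d) * int (d div 2)
        + 2 * (of_bool (odd d) * (\<Sum>j\<in>{1..<d}. of_bool (even j) * cos_quarter (int j))))))"
      using n unfolding series_m8_def divisor_series_nth[OF n]
      by (simp only: sum.distrib sum_subtractf sum_distrib_left right_diff_distrib distrib_left)
    also have "\<dots> = (\<Sum>d | d dvd n. 4 * (of_bool (odd d) * int (n div d)) - 2 * (of_bool (even d) * cos_quarter (int d) * int d))"
    proof (intro sum.cong refl)
      fix d assume "d \<in> {d. d dvd n}"
      then have "0 < n div d" using n by (auto simp: div_greater_zero_iff dvd_imp_le dvd_pos_nat)
      then have 1: "int (n div d - 1) = int (n div d) - 1" by simp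
      show "4 * chi_m8 (int d) + 4 * (of_bool (odd d) * cos_quarter 0 * int (n div d - 1)
         - (of_bool (even d) * cos_quarter (int d) * int (d div 2)
          + 2 * (of_bool (odd d) * (\<Sum>j\<in>{1..<d}. of_bool (even j) * cos_quarter (int j)))))
        = 4 * (of_bool (odd d) * int (n div d)) - 2 * (of_bool (even d) * cos_quarter (int d) * int d)"
      proof (cases "even d")
        case True
        then have "2 * int (d div 2) = int d" by (auto elim: evenE)
        then show ?thesis using True by (simp add: chi_even)
      next
        case False
        show ?thesis
          unfolding 1 using False sum_cos_quarter[OF False] by (simp only: cos_quarter_def) simp
      qed
    qed
    finally have LL: "4 * series_m8 $ n + 4 * (series_m8 * series_m8) $ n
      = (\<Sum>d | d dvd n. 4 * (of_bool (odd d) * int (n div d)))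
        - 2 * (\<Sum>d | d dvd n. of_bool (even d) * cos_quarter (int d) * int d)"
      by (simp only: sum_subtractf sum_distrib_left)
    have "2 * (series_m4 * ?b2) $ n = quad_sum n (\<lambda>a x b y. True)
        (\<lambda>a x b y. of_bool (odd a \<and> odd b \<and> even y) * (cos_half (int a - int b) - cos_half (int a + int b)))"
      unfolding series_m4_dilate unfolding series_m4_def divisor_series_mult_nth quad_sum_cmult[symmetric]
      by (rule quad_sum_cong) (auto simp: cos_half_addition chi_even)
    also have "\<dots> = (\<Sum>d | d dvd n. of_bool (odd d) * cos_half 0 * int ((n div d - 1) div 2))
    - (\<Sum>d | d dvd n. of_bool (even d \<and> even (n div d)) * cos_half (int d) * int (d div 2)
        + (1 + of_bool (even (n div d))) * (of_bool (odd d) * (\<Sum>j\<in>{1..<d}. of_bool (even j) * cos_half (int j))))"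
      by (rule liouville_odd_odd_even[where F = cos_half, OF n cos_half_minus])
    finally have "4 * series_m4 $ n + 4 * ?b2 $ n + 8 * (2 * (series_m4 * ?b2) $ n) = (\<Sum>d | d dvd n.
        4 * chi_m4 (int d) + 4 * (if even (n div d) then chi_m4 (int d) else 0) + 8 * (
        of_bool (odd d) * cos_half 0 * int ((n div d - 1) div 2)
        - (of_bool (even d \<and> even (n div d)) * cos_half (int d) * int (d div 2)
        + (1 + of_bool (even (n div d))) * (of_bool (odd d) * (\<Sum>j\<in>{1..<d}. of_bool (even j) * cos_half (int j))))))"
      using n unfolding series_m4_dilate unfolding series_m4_def divisor_series_nth[OF n]
      by (simp only: sum.distrib sum_subtractf sum_distrib_left right_diff_distrib distrib_left)
    also have "\<dots> = (\<Sum>d | d dvd n. 4 * (of_bool (odd d) * int (n div d))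
        - 4 * (of_bool (even d \<and> even (n div d)) * cos_half (int d) * int d))"
    proof (intro sum.cong refl)
      fix d assume "d \<in> {d. d dvd n}"
      then have pos: "0 < n div d" using n by (auto simp: div_greater_zero_iff dvd_imp_le dvd_pos_nat)
      show "4 * chi_m4 (int d) + 4 * (if even (n div d) then chi_m4 (int d) else 0) + 8 * (
        of_bool (odd d) * cos_half 0 * int ((n div d - 1) div 2)
        - (of_bool (even d \<and> even (n div d)) * cos_half (int d) * int (d div 2)
        + (1 + of_bool (even (n div d))) * (of_bool (odd d) * (\<Sum>j\<in>{1..<d}. of_bool (even j) * cos_half (int j)))))
        = 4 * (of_bool (odd d) * int (n div d)) - 4 * (of_bool (even d \<and> even (n div d)) * cos_half (int d) * int d)"
      proof (cases "even d")
        case True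
        then have "2 * int (d div 2) = int d" by (auto elim: evenE)
        then show ?thesis using True by (simp add: chi_even)
      next
        case False
        have "2 * int ((e - 1) div 2) + 1 + of_bool (even e) = int e" if e: "0 < e" for e :: nat
        proof -
          obtain c where "e = Suc c" using e by (cases e) auto
          then show ?thesis by (cases "even c") (auto elim!: evenE oddE)
        qed
        from this[OF pos] have "2 * int ((n div d - 1) div 2) + 1 + of_bool (even (n div d)) = int (n div d)" .
        then show ?thesis
          using False sum_cos_half[OF False] by (cases "even (n div d)") (simp_all add: cos_half_def)
      qed
    qed
    finally have RR: "4 * series_m4 $ n + 4 * ?b2 $ n + 8 * (2 * (series_m4 * ?b2) $ n)
      = (\<Sum>d | d dvd n. 4 * (of_bool (odd d) * int (n div d)))
        - 4 * (\<Sum>d | d dvd n. of_bool (even d \<and> even (n div d)) * cos_half (int d) * int d)"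
      by (simp only: sum_subtractf sum_distrib_left)
    show ?thesis
      unfolding L R fps_add_nth numeral_mult_nth
      using LL RR sum_even_divisors_cos[OF n] by simp
  qed
qed

text \<open>The number of representations by \<open>x^2 + 2 y^2\<close>. The square of the left side is known from the two-square
theorem and equals the square of the right side; the constant terms decide the sign.\<close>

lemma phi_phi_dilate: "phi * (phi oo fps_X ^ 2) = 1 + 2 * series_m8"
proof -
  let ?T = "phi * (phi oo fps_X ^ 2)"
  have "?T * ?T = (phi * phi) * ((phi * phi) oo fps_X ^ 2)"
    by (simp add: compose_X_power_mult mult_ac)
  also have "\<dots> = (1 + 2 * series_m8) * (1 + 2 * series_m8)"
    by (simp only: phi_squared_divisor_series series_m8_squared)
  finally have "(?T - (1 + 2 * series_m8)) * (?T + (1 + 2 * series_m8)) = 0"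
    by (simp add: algebra_simps)
  moreover have "(?T + (1 + 2 * series_m8)) $ 0 = 2"
    by (simp add: phi_nth series_m8_def)
  then have "?T + (1 + 2 * series_m8) \<noteq> 0" by (metis fps_zero_nth zero_neq_numeral)
  ultimately show ?thesis by simp
qed

section \<open>The coefficients of psi times the cube of phi\<close>

text \<open>The weight two divisor sum arises from \<open>liouville_odd_even\<close> with \<open>F = chi_8\<close>. The equation
\<open>a x + b y = n\<close> is doubled to \<open>a (2 x) + (2 b) y = 2 n\<close>, since
\<open>2 chi_m8(a) chi_m4(b) = chi_8(a - 2 b) - chi_8(a + 2 b)\<close> calls for an even second coefficient.\<close>

lemma series_m8_times_m4_odd_nth:
  assumes "odd n"
  shows "((1 + 2 * series_m8) * series_m4_odd) $ n = (\<Sum>d | d dvd n. chi_8 (int d) * int (n div d))"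
proof -
  have n: "0 < n" using assms by (rule odd_pos)
  have "2 * (series_m8 * series_m4_odd) $ n
      = quad_sum n (\<lambda>a x b y. True) (\<lambda>a x b y. 2 * (chi_m8 (int a) * (if odd y then chi_m4 (int b) else 0)))"
    unfolding series_m8_def series_m4_odd_def divisor_series_mult_nth quad_sum_cmult ..
  also have "\<dots> = quad_sum (2 * n) (\<lambda>a x b y. even x \<and> even b)
      (\<lambda>a x b y. 2 * (chi_m8 (int a) * (if odd y then chi_m4 (int (b div 2)) else 0)))"
    by (rule quad_sum_reindex[where h = "\<lambda>(a, x, b, y). (a, 2 * x, 2 * b, y)" and k = "\<lambda>(a, x, b, y). (a, x div 2, b div 2, y)"])
       (auto elim!: evenE)
  also have "\<dots> = quad_sum (2 * n) (\<lambda>a x b y. even x \<and> even b)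
      (\<lambda>a x b y. of_bool (odd a \<and> even b \<and> odd (x + y)) * (chi_8 (int a - int b) - chi_8 (int a + int b)))"
  proof (rule quad_sum_cong, simp, goal_cases)
    case (1 a x b y)
    then obtain c where b: "b = 2 * c" by (elim conjE evenE)
    show ?case
    proof (cases "odd a")
      case True
      then show ?thesis using 1 chi_8_addition[of "int a" "int c"] by (simp add: b)
    qed (simp add: chi_even)
  qed
  also have "\<dots> = quad_sum (2 * n) (\<lambda>a x b y. True)
      (\<lambda>a x b y. of_bool (odd a \<and> even b \<and> odd (x + y)) * (chi_8 (int a - int b) - chi_8 (int a + int b)))"
  proof (rule quad_sum_restrict[symmetric])
    fix a x b y :: nat
    assume n: "a * x + b * y = 2 * n" and "\<not> (even x \<and> even b)"
    have "even (a * x + b * y)" unfolding n by simp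
    then have "(even a \<or> even x) = (even b \<or> even y)" by simp
    with \<open>\<not> (even x \<and> even b)\<close>
    show "of_bool (odd a \<and> even b \<and> odd (x + y)) * (chi_8 (int a - int b) - chi_8 (int a + int b)) = 0"
      by auto
  qed
  also have "\<dots> = (\<Sum>d | d dvd 2 * n. of_bool (odd d) * chi_8 (int d) * int (2 * n div d div 2))
    - (\<Sum>d | d dvd 2 * n. of_bool (odd (2 * n div d)) * (\<Sum>j\<in>{1..<d}. of_bool (odd j) * chi_8 (int j)))"
    using n by (intro liouville_odd_even chi_8_minus) simp
  also have "(\<Sum>d | d dvd 2 * n. of_bool (odd d) * chi_8 (int d) * int (2 * n div d div 2))
      = (\<Sum>d | d dvd n. chi_8 (int d) * int (n div d))"
  proof (rule sum.mono_neutral_cong_right)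
    show "finite {d. d dvd 2 * n}" using n by (intro finite_divisors_nat) simp
    show "{d. d dvd n} \<subseteq> {d. d dvd 2 * n}" by auto
    show "\<forall>d\<in>{d. d dvd 2 * n} - {d. d dvd n}. of_bool (odd d) * chi_8 (int d) * int (2 * n div d div 2) = 0"
    proof
      fix d assume d: "d \<in> {d. d dvd 2 * n} - {d. d dvd n}"
      have "even d"
      proof (rule ccontr)
        assume "odd d"
        then have "coprime d 2" by simp
        then have "d dvd n" using d by (simp add: coprime_dvd_mult_right_iff)
        then show False using d by simp
      qed
      then show "of_bool (odd d) * chi_8 (int d) * int (2 * n div d div 2) = 0" by simp
    qed
    fix d assume d: "d \<in> {d. d dvd n}"
    then have "odd d" using assms by (auto elim: dvdE)
    moreover have "2 * n div d div 2 = n div d" using d n by (auto elim!: dvdE)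
    ultimately show "of_bool (odd d) * chi_8 (int d) * int (2 * n div d div 2) = chi_8 (int d) * int (n div d)" by simp
  qed
  also have "(\<Sum>d | d dvd 2 * n. of_bool (odd (2 * n div d)) * (\<Sum>j\<in>{1..<d}. of_bool (odd j) * chi_8 (int j)))
      = (\<Sum>d | d dvd 2 * n \<and> odd (2 * n div d). \<Sum>j\<in>{1..<d}. of_bool (odd j) * chi_8 (int j))"
    using n by (intro sum.mono_neutral_cong_right) (auto simp: finite_divisors_nat simp del: sum_of_bool_mult_eq)
  also have "\<dots> = (\<Sum>d | d dvd n. chi_m4 (int d))"
  proof (rule sum.reindex_bij_witness[where i = "\<lambda>d. 2 * d" and j = "\<lambda>d. d div 2"], goal_cases)
    case (1 d)
    then obtain e where e: "2 * n = d * e" "odd e" by (metis (mono_tags) dvd_mult_div_cancel mem_Collect_eq)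
    then have "even d" by (metis even_mult_iff even_numeral)
    then show ?case by simp
  next
    case (2 d)
    then obtain e where e: "2 * n = d * e" "odd e" by (metis (mono_tags) dvd_mult_div_cancel mem_Collect_eq)
    then have "even d" by (metis even_mult_iff even_numeral)
    then have "n = (d div 2) * e" using e by (auto elim!: evenE)
    then show ?case by simp
  next
    case (3 d)
    then show ?case by simp
  next
    case (4 d)
    then have "odd (n div d)" using assms by (metis dvd_mult_div_cancel even_mult_iff mem_Collect_eq)
    then show ?case using 4 n by simp
  next
    case (5 d)
    then obtain e where e: "2 * n = d * e" "odd e" by (metis (mono_tags) dvd_mult_div_cancel mem_Collect_eq)
    then have "even d" by (metis even_mult_iff even_numeral)
    then obtain c where d: "d = 2 * c" by (elim evenE)
    then have "n = c * e" using e by simp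
    then have "odd c" using assms by simp
    then show ?case using sum_chi_8[of c] by (simp only: d) simp
  qed
  finally have "2 * (series_m8 * series_m4_odd) $ n = (\<Sum>d | d dvd n. chi_8 (int d) * int (n div d)) - series_m4_odd $ n"
    by (simp add: series_m4_odd_nth[OF assms])
  then show ?thesis
    by (simp add: distrib_right mult.assoc numeral_mult_nth)
qed

definition even_part :: "int fps \<Rightarrow> int fps" where
  "even_part f = Abs_fps (\<lambda>n. f $ (2 * n))"

lemma even_part_mult_dilate: "even_part (f * (g oo fps_X ^ 2)) = even_part f * g"
proof (rule fps_ext)
  fix n
  have "even_part (f * (g oo fps_X ^ 2)) $ n = (\<Sum>i=0..2 * n. f $ i * (if even (2 * n - i) then g $ ((2 * n - i) div 2) else 0))"
    by (simp add: even_part_def fps_mult_nth compose_X_power_nth)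
  also have "\<dots> = (\<Sum>i | i \<le> 2 * n \<and> even i. f $ i * g $ ((2 * n - i) div 2))"
    by (intro sum.mono_neutral_cong_right) auto
  also have "\<dots> = (\<Sum>i=0..n. f $ (2 * i) * g $ (n - i))"
    by (rule sum.reindex_bij_witness[where i = "\<lambda>i. 2 * i" and j = "\<lambda>i. i div 2"])
       (auto elim!: evenE simp: diff_mult_distrib2[symmetric])
  finally show "even_part (f * (g oo fps_X ^ 2)) $ n = (even_part f * g) $ n"
    by (simp add: even_part_def fps_mult_nth)
qed

lemma even_part_phi: "even_part phi = phi oo fps_X ^ 2"
proof (rule fps_ext)
  fix n
  have "(4::nat) dvd 2 * n \<longleftrightarrow> even n" "2 * n div 4 = n div 2" by presburger+
  moreover have "\<not> (0 < n \<and> 8 dvd 2 * n - 1)" by presburger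
  ultimately show "even_part phi $ n = (phi oo fps_X ^ 2) $ n"
    by (subst phi_dissection) (auto simp: even_part_def compose_X_power_nth numeral_mult_nth)
qed

lemma even_part_phi_squared: "even_part (phi * phi) = phi * phi"
proof (rule fps_ext)
  fix n
  show "even_part (phi * phi) $ n = (phi * phi) $ n"
    unfolding even_part_def fps_nth_Abs_fps
    by (subst phi_squared_dissection) (simp only: fps_add_nth numeral_mult_nth, simp add: compose_X_power_nth series_m4_odd_even)
qed

text \<open>Exponents \<open>8 n\<close> in \<open>phi(x) phi(x^2) psi(x^4)^2\<close> are reached by taking the even part three times. The first
two replace a factor \<open>phi(x)\<close> by \<open>phi(x^2)\<close>; then \<open>psi^2 = phi psi(x^2)\<close> brings up the factor \<open>phi^2\<close>,
whose even part is again \<open>phi^2\<close>.\<close>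

lemma psi_phi_cubed_nth:
  "(psi * phi * (phi * phi)) $ n = (\<Sum>d | d dvd 8 * n + 1. chi_8 (int d) * int ((8 * n + 1) div d))"
proof -
  let ?f = "phi * ((phi * ((psi * psi) oo fps_X ^ 2)) oo fps_X ^ 2)"
  have "even_part ?f = phi * (((phi * (psi * psi))) oo fps_X ^ 2)"
    unfolding even_part_mult_dilate even_part_phi by (simp add: compose_X_power_mult mult_ac)
  then have "even_part (even_part ?f) = (phi oo fps_X ^ 2) * (phi * (psi * psi))"
    by (simp only: even_part_mult_dilate even_part_phi)
  also have "\<dots> = (phi * phi) * ((phi * psi) oo fps_X ^ 2)"
    unfolding psi_squared_factorization by (simp add: compose_X_power_mult mult_ac)
  finally have "even_part (even_part (even_part ?f)) = (phi * phi) * (phi * psi)"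
    by (simp only: even_part_mult_dilate even_part_phi_squared)
  then have "(psi * phi * (phi * phi)) $ n = even_part (even_part (even_part ?f)) $ n"
    by (simp add: mult_ac)
  also have "\<dots> = ?f $ (8 * n)"
    by (simp add: even_part_def)
  also have "?f = (phi * (phi oo fps_X ^ 2)) * ((psi * psi) oo fps_X ^ 4)"
    by (simp add: compose_X_power_mult compose_X_power_compose mult_ac)
  also have "\<dots> $ (8 * n) = (fps_X * ((phi * (phi oo fps_X ^ 2)) * ((psi * psi) oo fps_X ^ 4))) $ (8 * n + 1)"
    by simp
  also have "fps_X * ((phi * (phi oo fps_X ^ 2)) * ((psi * psi) oo fps_X ^ 4)) = (1 + 2 * series_m8) * series_m4_odd"
    unfolding phi_phi_dilate[symmetric] psi_squared_divisor_series[symmetric] by (simp only: mult_ac)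
  also have "\<dots> $ (8 * n + 1) = (\<Sum>d | d dvd 8 * n + 1. chi_8 (int d) * int ((8 * n + 1) div d))"
    by (rule series_m8_times_m4_odd_nth) simp
  finally show ?thesis .
qed

section \<open>Arithmetic at exponents 8n + 1 divisible by 5 exactly once\<close>

text \<open>Since \<open>d^2 \<equiv> 1\<close> modulo 8, the cofactor \<open>e\<close> is \<open>5 d\<close> modulo 8, and \<open>chi_8(5) = -1\<close>.\<close>

lemma chi_8_cofactor:
  assumes "d * e mod 8 = (5 :: int)"
  shows "chi_8 e = - chi_8 d" "(e - 5 * d) mod 8 = 0"
proof -
  have "odd z" if "z mod 8 = 5" for z :: int using that by presburger
  from this[OF assms] have "odd (d * e)" .
  then have "odd d" "odd e" by simp_all
  note cases = odd_mod_8[OF this(1)] odd_mod_8[OF this(2)]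
  have "((d mod 8) * (e mod 8)) mod 8 = 5" using assms by (simp only: mod_mult_eq)
  moreover have "(e - 5 * d) mod 8 = (e mod 8 - 5 * (d mod 8)) mod 8"
    by (intro mod_diff_cong mod_mult_cong) simp_all
  ultimately show "chi_8 e = - chi_8 d" "(e - 5 * d) mod 8 = 0"
    unfolding chi_8_def using cases by (elim disjE; simp)+
qed

text \<open>Let \<open>S\<close> be the sum. Exchanging \<open>d\<close> with its cofactor changes the sign of \<open>chi_8\<close>, so
\<open>\<Sum> chi_8(d) d = - S\<close>; and replacing the cofactor by \<open>5 d\<close> modulo 8 gives
\<open>S \<equiv> 5 \<Sum> chi_8(d) d = - 5 S\<close>. Thus 8 divides \<open>6 S\<close>.\<close>

lemma four_dvd_twisted_divisor_sum:
  assumes "M mod 8 = (5 :: nat)"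
  shows "4 dvd (\<Sum>d | d dvd M. chi_8 (int d) * int (M div d))"
proof -
  define S where "S = (\<Sum>d | d dvd M. chi_8 (int d) * int (M div d))"
  have M: "0 < M" using assms by (cases M) auto
  have cof: "int d * int (M div d) mod 8 = 5" if "d dvd M" for d
  proof -
    have "d * (M div d) = M" using that by simp
    then show ?thesis using assms by (metis of_nat_mult of_nat_numeral zmod_int)
  qed
  have "(\<Sum>d | d dvd M. chi_8 (int d) * int d) = (\<Sum>d | d dvd M. chi_8 (int (M div d)) * int (M div d))"
    using M by (intro sum.reindex_bij_witness[where i = "\<lambda>d. M div d" and j = "\<lambda>d. M div d"]) (auto elim!: dvdE)
  also have "\<dots> = - S"
    unfolding S_def sum_negf[symmetric]
    by (intro sum.cong refl) (simp add: chi_8_cofactor(1)[OF cof])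
  finally have "S + 5 * S = S - 5 * (\<Sum>d | d dvd M. chi_8 (int d) * int d)" by simp
  also have "\<dots> = (\<Sum>d | d dvd M. chi_8 (int d) * (int (M div d) - 5 * int d))"
    unfolding S_def sum_distrib_left sum_subtractf[symmetric] by (intro sum.cong refl) (simp add: algebra_simps)
  also have "8 dvd \<dots>"
    using chi_8_cofactor(2)[OF cof] by (intro dvd_sum dvd_mult) (simp add: dvd_eq_mod_eq_0)
  finally show ?thesis unfolding S_def[symmetric] by presburger
qed

text \<open>The divisors of \<open>5 M\<close> are \<open>d\<close> and \<open>5 d\<close> for \<open>d dvd M\<close>, and together they contribute
\<open>(5 + chi_8(5)) chi_8(d) M / d\<close>.\<close>

lemma sixteen_dvd_twisted_divisor_sum:
  assumes "M mod 8 = (5 :: nat)" "\<not> 5 dvd M"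
  shows "16 dvd (\<Sum>d | d dvd 5 * M. chi_8 (int d) * int (5 * M div d))"
proof -
  have M: "0 < M" using assms by (cases M) auto
  have p: "prime (5::nat)" by simp
  have set: "{d. d dvd 5 * M} = {d. d dvd M} \<union> (*) 5 ` {d. d dvd M}"
  proof (intro equalityI subsetI)
    fix d assume d: "d \<in> {d. d dvd 5 * M}"
    show "d \<in> {d. d dvd M} \<union> (*) 5 ` {d. d dvd M}"
    proof (cases "5 dvd d")
      case True
      then show ?thesis using d by (auto elim!: dvdE)
    next
      case False
      then have "coprime d 5" using p by (metis coprime_commute prime_imp_coprime)
      then show ?thesis using d by (simp add: coprime_dvd_mult_right_iff)
    qed
  qed auto
  have disj: "{d. d dvd M} \<inter> (*) 5 ` {d. d dvd M} = {}"
    using assms(2) by (auto intro: dvd_trans)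
  have "(\<Sum>d | d dvd 5 * M. chi_8 (int d) * int (5 * M div d))
    = (\<Sum>d | d dvd M. chi_8 (int d) * int (5 * M div d)) + (\<Sum>d\<in>(*) 5 ` {d. d dvd M}. chi_8 (int d) * int (5 * M div d))"
    unfolding set using M disj by (intro sum.union_disjoint) (auto simp: finite_divisors_nat)
  also have "(\<Sum>d\<in>(*) 5 ` {d. d dvd M}. chi_8 (int d) * int (5 * M div d))
    = (\<Sum>d | d dvd M. chi_8 (int (5 * d)) * int (5 * M div (5 * d)))"
    by (subst sum.reindex) (auto intro: inj_onI)
  also have "(\<Sum>d | d dvd M. chi_8 (int d) * int (5 * M div d)) + \<dots>
    = (\<Sum>d | d dvd M. 4 * (chi_8 (int d) * int (M div d)))"
    unfolding sum.distrib[symmetric]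
  proof (intro sum.cong refl)
    fix d assume d: "d \<in> {d. d dvd M}"
    have "odd M" using assms(1) by presburger
    then have "odd (int d)" using d by (auto elim: dvdE)
    have "int (5 * d) mod 8 = (5 * (int d mod 8)) mod 8" by (simp add: mod_simps)
    then have "chi_8 (int (5 * d)) = - chi_8 (int d)"
      unfolding chi_8_def using odd_mod_8[OF \<open>odd (int d)\<close>] by (elim disjE) simp_all
    moreover have "5 * M div d = 5 * (M div d)" using d by (simp add: div_mult_swap)
    ultimately show "chi_8 (int d) * int (5 * M div d) + chi_8 (int (5 * d)) * int (5 * M div (5 * d))
      = 4 * (chi_8 (int d) * int (M div d))" by simp
  qed
  also have "\<dots> = 4 * (\<Sum>d | d dvd M. chi_8 (int d) * int (M div d))"
    by (rule sum_distrib_left[symmetric])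
  finally show ?thesis using four_dvd_twisted_divisor_sum[OF assms(1)] by (auto elim!: dvdE)
qed

text \<open>The form is anisotropic modulo 5, because -8 is not a square there.\<close>

lemma five_dvd_form:
  fixes u j :: nat
  assumes "5 dvd u\<^sup>2 + 8 * j\<^sup>2"
  shows "25 dvd u\<^sup>2 + 8 * j\<^sup>2"
proof -
  have "(u\<^sup>2 + 8 * j\<^sup>2) mod 5 = ((u mod 5)\<^sup>2 + 8 * (j mod 5)\<^sup>2) mod 5"
    by (intro mod_add_cong mod_mult_cong) (simp_all add: power_mod)
  moreover have "u mod 5 \<in> {0, 1, 2, 3, 4}" "j mod 5 \<in> {0, 1, 2, 3, 4}" by (simp; presburger)+
  ultimately have "u mod 5 = 0 \<and> j mod 5 = 0"
    using assms unfolding insert_iff empty_iff dvd_eq_mod_eq_0 by (elim disjE; simp)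
  then obtain u' j' where "u = 5 * u'" "j = 5 * j'" by (auto elim!: dvdE)
  then have "u\<^sup>2 + 8 * j\<^sup>2 = 25 * (u'\<^sup>2 + 8 * j'\<^sup>2)" by (simp add: power2_eq_square algebra_simps)
  then show ?thesis by simp
qed

text \<open>A nonzero term would give \<open>8 n + 1 = (2 k + 1)^2 + 8 j^2\<close>, a number divisible by 5 but not by 25.\<close>

lemma psi_phi_nth_eq_0:
  assumes "8 * n + 1 = 5 * M" "\<not> 5 dvd M"
  shows "(psi * phi) $ n = 0"
proof -
  have "psi $ i * phi $ (n - i) = 0" if "i \<in> {0..n}" for i
  proof (rule ccontr)
    assume "psi $ i * phi $ (n - i) \<noteq> 0"
    then obtain k where k: "i = k * (k + 1) div 2" and p: "phi $ (n - i) \<noteq> 0"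
      by (auto simp: psi_nth split: if_splits)
    from p have "\<exists>j. n - i = j\<^sup>2"
      by (cases "n - i = 0") (auto simp: phi_nth intro: exI[of _ 0] split: if_splits)
    then obtain j where j: "n - i = j\<^sup>2" by blast
    have "2 * i = k * (k + 1)" unfolding k by (rule dvd_mult_div_cancel) simp
    then have "8 * i + 1 = (2 * k + 1)\<^sup>2" by (simp add: power2_eq_square algebra_simps)
    moreover have "n = i + j\<^sup>2" using j that by simp
    ultimately have eq: "5 * M = (2 * k + 1)\<^sup>2 + 8 * j\<^sup>2" using assms(1) by simp
    then have "25 dvd 5 * M" using five_dvd_form[of "2 * k + 1" j] by (metis dvd_triv_left)
    then show False using assms(2) by presburger
  qed
  then show ?thesis by (simp add: fps_mult_nth sum.neutral)
qed

theorem theorem5p1: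
  fixes \<alpha> n :: nat
  assumes "\<alpha> \<in> {8, 13, 18, 23}"
  shows "[b4 (25 * n + \<alpha>) = 0] (mod 16)"
proof -
  define m where "m = 25 * n + \<alpha>"
  define M where "M = (8 * m + 1) div 5"
  have "(\<alpha> = 8 \<or> \<alpha> = 13) \<or> (\<alpha> = 18 \<or> \<alpha> = 23)" using assms by simp
  then have M: "8 * m + 1 = 5 * M" "M mod 8 = 5" "\<not> 5 dvd M"
    unfolding M_def m_def by (elim disjE; simp; presburger)+
  \<comment> \<open>the series psi / phi\<close>
  define C where "C = b4_series oo - fps_X"
  have "(b4_series * (phi oo - fps_X)) oo - fps_X = (psi oo - fps_X) oo - fps_X"
    by (simp only: b4_series_phi_neg)
  then have C: "C * phi = psi"
    by (simp only: C_def compose_neg_X_mult neg_X_neg_X)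
  \<comment> \<open>expand \<open>C (1 - phi^2)^2\<close>, a multiple of 16\<close>
  have "C = 2 * (psi * phi) - psi * phi * (phi * phi) + C * (1 - phi * phi) * (1 - phi * phi)"
    unfolding C[symmetric] by (simp add: algebra_simps)
  also have "C * (1 - phi * phi) * (1 - phi * phi) = 16 * (C * series_m4 * series_m4)"
    by (simp add: phi_squared_divisor_series algebra_simps)
  finally have "C $ m = (2 * (psi * phi) - psi * phi * (phi * phi) + 16 * (C * series_m4 * series_m4)) $ m"
    by simp
  also have "\<dots> = 16 * (C * series_m4 * series_m4) $ m - (\<Sum>d | d dvd 5 * M. chi_8 (int d) * int (5 * M div d))"
    by (simp only: fps_add_nth fps_sub_nth numeral_mult_nth psi_phi_nth_eq_0[OF M(1,3)] psi_phi_cubed_nth M(1))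
  also have "16 dvd \<dots>"
    using sixteen_dvd_twisted_divisor_sum[OF M(2,3)] by (intro dvd_diff) auto
  finally have "16 dvd (-1) ^ m * int (b4 m)"
    by (simp add: C_def compose_neg_X_nth b4_series_def)
  then have "16 dvd int (b4 m)"
    by (cases "even m") simp_all
  then have "16 dvd b4 m" by presburger
  then show ?thesis by (simp add: m_def cong_0_iff)
qed

end
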